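(* There is a constant $C>0$, depending only on $N$, the $a_i$'s, the $\alpha_i$'s and $U$ (and in particular independent of $T$, $\phi$, $\mathcal R$, $\chi_*$, $M_*$, $\mathcal Z$, $u$, $\Psi$), such that $$\int_0^T\!\!\int_U\mathcal K|\nabla u|^2dxdt\le C\Big\{\chi_*^2\phi\|\bar u_0\|_{L^2}^2+\chi_*^{2(4+a)}TM_*^2(M_*+1)^2+\chi_*^{2(2+a)}\mathcal E_*\Big\},$$ $$\int_0^T\!\!\int_U|\nabla u|^{2-a}dxdt\le C\Big\{\chi_*^2\phi\|\bar u_0\|_{L^2}^2+\chi_*^{2(4+a)}T(M_*+1)^4+\chi_*^{2(2+a)}\mathcal E_*\Big\}.$$ Consequently, $$\int_0^T\!\!\int_U\mathcal K|\nabla u|^2dxdt\le C\chi_*^{2(4+a)}(M_*+1)^2\mathcal N_0,$$ $$\int_0^T\!\!\int_U\mathcal K|\nabla u|^2dxdt\le C\chi_*^{2(4+a)}(M_*+1)^4\mathcal N_*,$$ $$\int_0^T\!\!\int_U|\nabla u|^{2-a}dxdt\le C\chi_*^{2(4+a)}(M_*+1)^4\mathcal N_*.$$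
   Context: $N\ge1$ is an integer, $0=\alpha_0<\alpha_1<\dots<\alpha_N$ are real numbers, $a_0,\dots,a_N>0$ are constants, and $g(s)=\sum_{i=0}^N a_is^{\alpha_i}$ for $s\ge0$. $\vec k\in\mathbb R^3$ is a fixed unit vector, $\mathbf J$ is the $3\times3$ matrix with $\mathbf Jx=\vec k\times x$. Constants: $0<\phi\le1$, $\mathcal G>0$, $\Omega\ge0$, $\rho_*\ge0$, and $\mathcal R=2\rho_*\Omega/\phi$. The function $F:\mathbb R^3\to\mathbb R^3$, $F(v)=g(|v|)v+\mathcal R\,\mathbf Jv$, is a $C^1$ bijection whose inverse $X=F^{-1}$ is also $C^1$. $a=\frac{\alpha_N}{1+\alpha_N}\in(0,1)$. $U\subset\mathbb R^3$ is a nonempty open bounded set with $C^1$ boundary $\Gamma$; $T>0$; $e_0:\mathbb R\to\mathbb R^3$ is smooth with $|e_0(t)|=1$, and $\mathcal Z(x,t)=-\mathcal Ge_0(t)+\Omega^2\mathbf J^2x$. Put $r_0=\max\{|x|:x\in\bar U\}$, $\Omega_*=\Omega\sqrt{r_0/\mathcal G}$, $d_*=\sqrt{\mathcal G/r_0}\,\max\{2\rho_*/\phi,\sqrt{r_0},2^{1/4}\}$ and $\chi_*=\max\{1,d_*(1+\Omega_* )\}$. $u\in C^{2,1}_{x,t}(\bar U\times(0,T])\cap C(\bar U\times[0,T])$ (not necessarily non-negative) solves $\phi u_t=\nabla\cdot(X(\nabla u+u^2\mathcal Z))$ in $U\times(0,T]$, $u(x,0)=u_0(x)$ in $U$, $u=\psi$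 on $\Gamma\times(0,T]$. $\Psi\in C^1(\bar U\times[0,T])$ is an extension of $\psi$, i.e. $\Psi=\psi$ on $\Gamma\times(0,T]$, and $\bar u_0=u_0-\Psi(\cdot,0)$. Spatial norms such as $\|\cdot\|_{L^2}$ are over $U$. The weight is $\mathcal K(x,t)=(1+|\nabla u(x,t)+u^2(x,t)\mathcal Z(x,t)|)^{-a}$. Quantities: $$M_*=\sup_{U\times[0,T]}|u|,\quad \mathcal E_*=\int_0^T\!\!\int_U(|\nabla\Psi|^2+\phi|\Psi_t|^2+\phi\Psi^2)dxdt,$$ $$\mathcal N_0=\phi\|\bar u_0\|_{L^2}^2+TM_*^2+\mathcal E_*,\quad \mathcal N_*=\phi\|\bar u_0\|_{L^2}^2+T+\mathcal E_*.$$ *)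

theory Defs
  imports "HOL-Analysis.Analysis"
begin

section \<open>Differential operators\<close>

definition grad :: "(real^3 \<Rightarrow> real) \<Rightarrow> real^3 \<Rightarrow> real^3" where
  "grad f x = (THE D. GDERIV f x :> D)"

definition divergence :: "(real^3 \<Rightarrow> real^3) \<Rightarrow> real^3 \<Rightarrow> real" where
  "divergence V x = trace (jacobian V (at x))"

text \<open>Time derivative on \<open>[0,T]\<close>; one-sided at the end points.\<close>

definition time_deriv :: "real \<Rightarrow> (real^3 \<Rightarrow> real \<Rightarrow> real) \<Rightarrow> real^3 \<Rightarrow> real \<Rightarrow> real" where
  "time_deriv T w x t = vector_derivative (w x) (at t within {0..T})"

section \<open>Regularity classes\<close>

text \<open>Every boundary point has a ball in which, after an orthogonal change of coordinates, the
  set is the region strictly above the graph of a \<open>C\<^sup>1\<close> function of two variables.\<close>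

definition C1_boundary :: "(real^3) set \<Rightarrow> bool" where
  "C1_boundary U \<longleftrightarrow>
     (\<forall>p \<in> frontier U. \<exists>r > 0. \<exists>Q :: real^3 \<Rightarrow> real^3. \<exists>\<gamma> :: real^2 \<Rightarrow> real. \<exists>\<gamma>'.
        orthogonal_transformation Q \<and>
        (\<forall>y. GDERIV \<gamma> y :> \<gamma>' y) \<and> continuous_on UNIV \<gamma>' \<and>
        U \<inter> ball p r = {x \<in> ball p r. Q x $ 3 > \<gamma> (vector [Q x $ 1, Q x $ 2])})"

definition smooth_curve :: "(real \<Rightarrow> real^3) \<Rightarrow> bool" where
  "smooth_curve e \<longleftrightarrow>
     (\<forall>n. \<forall>t. ((\<lambda>h s. vector_derivative h (at s)) ^^ n) e differentiable (at t))"

text \<open>Regularity up to the boundary of \<open>U\<close> means, as usual, that the derivatives exist in \<open>U\<close> and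
  extend continuously to the closure of \<open>U\<close>. The witnesses below are these extensions.\<close>

text \<open>\<open>C\<^bsup>2,1\<^esup>\<close> in \<open>(x,t)\<close> on \<open>closure U \<times> (0,T]\<close>: \<open>D\<close>, \<open>H\<close>, \<open>E\<close> are the spatial gradient, the spatial
  Hessian and the time derivative.\<close>

definition C21 :: "(real^3) set \<Rightarrow> real \<Rightarrow> (real^3 \<Rightarrow> real \<Rightarrow> real) \<Rightarrow> bool" where
  "C21 U T u \<longleftrightarrow>
     continuous_on (closure U \<times> {0<..T}) (\<lambda>(x, t). u x t) \<and>
     (\<exists>(D :: real^3 \<Rightarrow> real \<Rightarrow> real^3) (H :: real^3 \<Rightarrow> real \<Rightarrow> real^3^3) (E :: real^3 \<Rightarrow> real \<Rightarrow> real).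
        continuous_on (closure U \<times> {0<..T}) (\<lambda>(x, t). D x t) \<and>
        continuous_on (closure U \<times> {0<..T}) (\<lambda>(x, t). H x t) \<and>
        continuous_on (closure U \<times> {0<..T}) (\<lambda>(x, t). E x t) \<and>
        (\<forall>x \<in> U. \<forall>t \<in> {0<..T}.
           GDERIV (\<lambda>y. u y t) x :> D x t \<and>
           ((\<lambda>y. D y t) has_derivative (\<lambda>h. H x t *v h)) (at x) \<and>
           (u x has_real_derivative E x t) (at t within {0..T})))"

text \<open>\<open>C\<^sup>1\<close> on \<open>closure U \<times> [0,T]\<close>.\<close>

definition C1_cyl :: "(real^3) set \<Rightarrow> real \<Rightarrow> (real^3 \<Rightarrow> real \<Rightarrow> real) \<Rightarrow> bool" where
  "C1_cyl U T w \<longleftrightarrow>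
     continuous_on (closure U \<times> {0..T}) (\<lambda>(x, t). w x t) \<and>
     (\<exists>(D :: real^3 \<Rightarrow> real \<Rightarrow> real^3) (E :: real^3 \<Rightarrow> real \<Rightarrow> real).
        continuous_on (closure U \<times> {0..T}) (\<lambda>(x, t). D x t) \<and>
        continuous_on (closure U \<times> {0..T}) (\<lambda>(x, t). E x t) \<and>
        (\<forall>x \<in> U. \<forall>t \<in> {0..T}.
           GDERIV (\<lambda>y. w y t) x :> D x t \<and>
           (w x has_real_derivative E x t) (at t within {0..T})))"

section \<open>The equation\<close>

text \<open>The term \<open>i = 0\<close> is separated since \<open>\<alpha> 0 = 0\<close> and \<open>0 powr 0 = 0\<close>, whereas \<open>s\<^sup>0 = 1\<close> is meant.\<close>

definition gfun :: "nat \<Rightarrow> (nat \<Rightarrow> real) \<Rightarrow> (nat \<Rightarrow> real) \<Rightarrow> real \<Rightarrow> real" where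
  "gfun N a \<alpha> s = a 0 + (\<Sum>i = 1..N. a i * s powr \<alpha> i)"

definition Jmat :: "real^3 \<Rightarrow> real^3^3" where
  "Jmat k = matrix (cross3 k)"

definition Rconst :: "real \<Rightarrow> real \<Rightarrow> real \<Rightarrow> real" where
  "Rconst \<phi> \<Omega> \<rho> = 2 * \<rho> * \<Omega> / \<phi>"

definition Fmap ::
  "nat \<Rightarrow> (nat \<Rightarrow> real) \<Rightarrow> (nat \<Rightarrow> real) \<Rightarrow> real \<Rightarrow> real^3 \<Rightarrow> real^3 \<Rightarrow> real^3" where
  "Fmap N a \<alpha> R k v = gfun N a \<alpha> (norm v) *\<^sub>R v + R *\<^sub>R (Jmat k *v v)"

definition Xmap ::
  "nat \<Rightarrow> (nat \<Rightarrow> real) \<Rightarrow> (nat \<Rightarrow> real) \<Rightarrow> real \<Rightarrow> real^3 \<Rightarrow> real^3 \<Rightarrow> real^3" where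
  "Xmap N a \<alpha> R k = inv (Fmap N a \<alpha> R k)"

definition Zfield ::
  "real \<Rightarrow> real \<Rightarrow> real^3 \<Rightarrow> (real \<Rightarrow> real^3) \<Rightarrow> real^3 \<Rightarrow> real \<Rightarrow> real^3" where
  "Zfield G \<Omega> k e0 x t = - (G *\<^sub>R e0 t) + \<Omega>\<^sup>2 *\<^sub>R ((Jmat k ** Jmat k) *v x)"

definition flux_arg ::
  "(real^3 \<Rightarrow> real \<Rightarrow> real^3) \<Rightarrow> (real^3 \<Rightarrow> real \<Rightarrow> real) \<Rightarrow> real^3 \<Rightarrow> real \<Rightarrow> real^3" where
  "flux_arg Z u x t = grad (\<lambda>y. u y t) x + (u x t)\<^sup>2 *\<^sub>R Z x t"

definition solves_ibvp ::
  "(real^3) set \<Rightarrow> real \<Rightarrow> real \<Rightarrow> (real^3 \<Rightarrow> real^3) \<Rightarrow> (real^3 \<Rightarrow> real \<Rightarrow> real^3) \<Rightarrow>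
   (real^3 \<Rightarrow> real) \<Rightarrow> (real^3 \<Rightarrow> real \<Rightarrow> real) \<Rightarrow> (real^3 \<Rightarrow> real \<Rightarrow> real) \<Rightarrow> bool" where
  "solves_ibvp U T \<phi> X Z u0 \<psi> u \<longleftrightarrow>
     (\<forall>x \<in> U. \<forall>t \<in> {0<..T}.
        \<phi> * time_deriv T u x t = divergence (\<lambda>y. X (flux_arg Z u y t)) x) \<and>
     (\<forall>x \<in> U. u x 0 = u0 x) \<and>
     (\<forall>x \<in> frontier U. \<forall>t \<in> {0<..T}. u x t = \<psi> x t)"

section \<open>Constants and integral quantities\<close>

definition r_max :: "(real^3) set \<Rightarrow> real" where
  "r_max U = Sup (norm ` closure U)"

definition Omega_star :: "real \<Rightarrow> real \<Rightarrow> real \<Rightarrow> real" where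
  "Omega_star G \<Omega> r0 = \<Omega> * sqrt (r0 / G)"

definition d_star :: "real \<Rightarrow> real \<Rightarrow> real \<Rightarrow> real \<Rightarrow> real" where
  "d_star \<phi> G \<rho> r0 = sqrt (G / r0) * Max {2 * \<rho> / \<phi>, sqrt r0, 2 powr (1 / 4)}"

definition chi_star :: "real \<Rightarrow> real \<Rightarrow> real \<Rightarrow> real \<Rightarrow> real \<Rightarrow> real" where
  "chi_star \<phi> G \<Omega> \<rho> r0 = max 1 (d_star \<phi> G \<rho> r0 * (1 + Omega_star G \<Omega> r0))"

definition weight ::
  "real \<Rightarrow> (real^3 \<Rightarrow> real \<Rightarrow> real^3) \<Rightarrow> (real^3 \<Rightarrow> real \<Rightarrow> real) \<Rightarrow> real^3 \<Rightarrow> real \<Rightarrow> real" where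
  "weight b Z u x t = (1 + norm (flux_arg Z u x t)) powr (- b)"

definition L2_norm_on :: "(real^3) set \<Rightarrow> (real^3 \<Rightarrow> real) \<Rightarrow> real" where
  "L2_norm_on U f = sqrt (LINT x:U|lborel. (f x)\<^sup>2)"

definition M_star :: "(real^3) set \<Rightarrow> real \<Rightarrow> (real^3 \<Rightarrow> real \<Rightarrow> real) \<Rightarrow> real" where
  "M_star U T u = (SUP (x, t) \<in> U \<times> {0..T}. \<bar>u x t\<bar>)"

definition E_star :: "(real^3) set \<Rightarrow> real \<Rightarrow> real \<Rightarrow> (real^3 \<Rightarrow> real \<Rightarrow> real) \<Rightarrow> real" where
  "E_star U T \<phi> \<Psi> =
     (LINT t:{0..T}|lborel. LINT x:U|lborel.
        (norm (grad (\<lambda>y. \<Psi> y t) x))\<^sup>2 + \<phi> * (time_deriv T \<Psi> x t)\<^sup>2 + \<phi> * (\<Psi> x t)\<^sup>2)"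

definition N_zero ::
  "(real^3) set \<Rightarrow> real \<Rightarrow> real \<Rightarrow> (real^3 \<Rightarrow> real) \<Rightarrow> (real^3 \<Rightarrow> real \<Rightarrow> real) \<Rightarrow>
   (real^3 \<Rightarrow> real \<Rightarrow> real) \<Rightarrow> real" where
  "N_zero U T \<phi> ubar0 u \<Psi> =
     \<phi> * (L2_norm_on U ubar0)\<^sup>2 + T * (M_star U T u)\<^sup>2 + E_star U T \<phi> \<Psi>"

definition N_star ::
  "(real^3) set \<Rightarrow> real \<Rightarrow> real \<Rightarrow> (real^3 \<Rightarrow> real) \<Rightarrow> (real^3 \<Rightarrow> real \<Rightarrow> real) \<Rightarrow> real" where
  "N_star U T \<phi> ubar0 \<Psi> = \<phi> * (L2_norm_on U ubar0)\<^sup>2 + T + E_star U T \<phi> \<Psi>"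

text \<open>The integrals to be estimated are taken in \<open>[0,\<infinity>]\<close>, so that a bound for them includes their
  finiteness.\<close>

definition weighted_grad_integral ::
  "(real^3) set \<Rightarrow> real \<Rightarrow> real \<Rightarrow> (real^3 \<Rightarrow> real \<Rightarrow> real^3) \<Rightarrow> (real^3 \<Rightarrow> real \<Rightarrow> real) \<Rightarrow> ennreal" where
  "weighted_grad_integral U T b Z u =
     (\<integral>\<^sup>+ t \<in> {0<..T}. (\<integral>\<^sup>+ x \<in> U.
        ennreal (weight b Z u x t * (norm (grad (\<lambda>y. u y t) x))\<^sup>2) \<partial>lborel) \<partial>lborel)"

definition power_grad_integral ::
  "(real^3) set \<Rightarrow> real \<Rightarrow> real \<Rightarrow> (real^3 \<Rightarrow> real \<Rightarrow> real) \<Rightarrow> ennreal" where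
  "power_grad_integral U T p u =
     (\<integral>\<^sup>+ t \<in> {0<..T}. (\<integral>\<^sup>+ x \<in> U.
        ennreal (norm (grad (\<lambda>y. u y t) x) powr p) \<partial>lborel) \<partial>lborel)"

end

theory Submission
  imports Defs
begin

text \<open>Testing the equation with \<open>w = u - \<Psi>\<close>, which vanishes on the boundary, gives an energy identity for
  \<open>\<phi>\<integral>w\<^sup>2 / 2\<close>. It yields the claim through two properties of the flux: with
  \<open>K(y) = (1 + |y|) powr - a\<close> one has \<open>|X(y)| \<le> c K(y) |y|\<close> and \<open>X(y) \<bullet> y \<ge> c \<chi>\<^sub>*\<^sup>-\<^sup>2 K(y) |y|\<^sup>2\<close>, where the
  rotation enters only through \<open>\<R> \<le> \<chi>\<^sub>*\<close>; together with \<open>|\<Z>| \<le> \<chi>\<^sub>*\<^sup>2\<close> the remaining terms are absorbed by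
  Young's inequality. The weight turns into the power \<open>2 - a\<close> since \<open>s powr (2 - a) \<le> 1 + 2 K(s) s\<^sup>2\<close>.

  The divergence theorem is needed only for fields \<open>X(\<dots>) w\<close> that vanish on the boundary. Extended by zero
  these are Lipschitz continuous, so it suffices that the boundary is a null set.\<close>

section \<open>Integration by parts\<close>

text \<open>The solution has classical derivatives only for positive times, so every identity is
  proved on \<open>[s,T]\<close> with \<open>s > 0\<close>. The limit \<open>s -> 0\<close> uses
  continuity of \<open>u\<close> for the initial energy and monotone convergence for the gradient
  integrals, which a priori might be infinite. The powers of chi_* can be traced: the energy
  inequality is multiplied by chi_*^2 to undo the loss in the coercivity of X, Young's inequality
  squares this factor to chi_*^4, and the body force, of size chi_*^2, contributes another chi_*^4
  to the term with u^2 Z. This gives the exponents 2, 8 and 4, which lie below the claimed ones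
  because chi_* is at least 1. The constant must not see the rotation. Each estimate of X therefore
  starts from the skew symmetry of J, by which the rotation drops out of F(v) . v and of the
  monotonicity of F. Bijectivity of F and differentiability of X come from the same monotonicity,
  with the coefficient a_0 as the uniform constant.\<close>

lemma frontier_graph_negligible:
  fixes U :: "(real^3) set" and Q :: "real^3 \<Rightarrow> real^3"
  assumes "open U" and Q: "orthogonal_transformation Q"
    and \<gamma>: "\<And>y. GDERIV \<gamma> y :> \<gamma>' y"
    and eq: "U \<inter> ball p r = {x \<in> ball p r. Q x $ 3 > \<gamma> (vector [Q x $ 1, Q x $ 2] :: real^2)}"
  shows "negligible (frontier U \<inter> ball p r)"
proof -
  \<comment> \<open>\<open>f\<close> parametrizes the graph, turned back by \<open>Q\<close>. As a
    differentiable map from the plane into space it has a null image, so it is enough to place the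
    frontier inside that image.\<close>
  define f where "f y = inv Q (vector [y $ 1, y $ 2, \<gamma> y])" for y :: "real^2"
  have \<gamma>d: "(\<gamma> has_derivative (\<lambda>h. h \<bullet> \<gamma>' y)) (at y)" for y
    using \<gamma>[of y] by (simp add: gderiv_def)
  have \<gamma>c: "continuous_on UNIV \<gamma>"
    by (meson \<gamma>d continuous_at_imp_continuous_on has_derivative_continuous)
  have linQ: "linear Q" "linear (inv Q)"
    using Q orthogonal_transformation_linear orthogonal_transformation_inv[OF Q]
    by (auto intro: orthogonal_transformation_linear)
  have vec_eq: "(vector [a, b, c] :: real^3) = a *\<^sub>R axis 1 1 + b *\<^sub>R axis 2 1 + c *\<^sub>R axis 3 1" for a b c :: real
    by (simp add: vec_eq_iff forall_3 axis_def)
  have "f differentiable_on UNIV"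
  proof (rule differentiable_at_imp_differentiable_on)
    fix y :: "real^2"
    have "((\<lambda>y. vector [y $ 1, y $ 2, \<gamma> y] :: real^3) has_derivative
        (\<lambda>h. (h$1) *\<^sub>R axis 1 1 + (h$2) *\<^sub>R axis 2 1 + (h \<bullet> \<gamma>' y) *\<^sub>R axis 3 1)) (at y)"
      unfolding vec_eq
      by (intro has_derivative_add has_derivative_scaleR_left \<gamma>d
           bounded_linear_imp_has_derivative bounded_linear_vec_nth)
    from bounded_linear.has_derivative[OF _ this, of "inv Q"] linQ(2)
    show "f differentiable at y"
      unfolding f_def differentiable_def using linear_conv_bounded_linear by blast
  qed
  then have neg: "negligible (range f)"
    by (rule negligible_differentiable_image_lowdim[rotated]) simp
  have "frontier U \<inter> ball p r \<subseteq> range f"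
  proof
    fix x assume x: "x \<in> frontier U \<inter> ball p r"
    let ?h = "\<lambda>x. Q x $ 3 - \<gamma> (vector [Q x $ 1, Q x $ 2] :: real^2)"
    have "x \<notin> U"
      using x \<open>open U\<close> by (simp add: frontier_def interior_open)
    then have le: "?h x \<le> 0"
      using x eq by (force simp: not_less)
    have vec2: "(vector [a, b] :: real^2) = a *\<^sub>R axis 1 1 + b *\<^sub>R axis 2 1" for a b :: real
      by (simp add: vec_eq_iff forall_2 axis_def)
    have contQ: "continuous_on UNIV Q"
      using linQ(1) linear_continuous_on linear_conv_bounded_linear by blast
    have conth: "continuous_on UNIV ?h"
      unfolding vec2
      by (intro continuous_intros continuous_on_compose2[OF \<gamma>c] contQ) auto
    \<comment> \<open>Where \<open>?h\<close> is negative the ball contains no point of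
      \<open>U\<close>, and this region is open; so no point of the closure of \<open>U\<close> lies
      in it.\<close>
    have "?h x \<ge> 0"
    proof (rule ccontr)
      assume "\<not> ?h x \<ge> 0"
      then have "x \<in> {x. ?h x < 0} \<inter> ball p r"
        using x by auto
      moreover have "open ({x. ?h x < 0} \<inter> ball p r)"
        by (intro open_Int open_ball open_Collect_less conth) auto
      moreover have "x \<in> closure U"
        using x by (simp add: frontier_def)
      ultimately have "({x. ?h x < 0} \<inter> ball p r) \<inter> U \<noteq> {}"
        using closure_iff_nhds_not_empty by blast
      then obtain z where "z \<in> U \<inter> ball p r" "?h z < 0" by blast
      then show False unfolding eq by simp
    qed
    with le have "Q x $ 3 = \<gamma> (vector [Q x $ 1, Q x $ 2])" by simp
    then have "vector [Q x $ 1, Q x $ 2, \<gamma> (vector [Q x $ 1, Q x $ 2])] = Q x"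
      by (simp add: vec_eq_iff forall_3)
    then have "f (vector [Q x $ 1, Q x $ 2]) = x"
      unfolding f_def using orthogonal_transformation_inj[OF Q] by simp
    then show "x \<in> range f" by (metis rangeI)
  qed
  with neg show ?thesis by (rule negligible_subset)
qed

lemma C1_boundary_negligible_frontier:
  fixes U :: "(real^3) set"
  assumes "open U" "C1_boundary U"
  shows "negligible (frontier U)"
proof -
  have *: "\<exists>r>0. negligible (frontier U \<inter> ball p r)" if fp: "p \<in> frontier U" for p
  proof -
    obtain r \<gamma> \<gamma>' and Q :: "real^3 \<Rightarrow> real^3" where "r > 0" "orthogonal_transformation Q" "\<forall>y :: real^2. GDERIV \<gamma> y :> \<gamma>' y"
      "U \<inter> ball p r = {x \<in> ball p r. Q x $ 3 > \<gamma> (vector [Q x $ 1, Q x $ 2])}"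
      using assms(2)[unfolded C1_boundary_def, THEN bspec, OF fp] by (elim exE conjE) (rule that)
    then show ?thesis using frontier_graph_negligible[OF assms(1)] by blast
  qed
  \<comment> \<open>A set that is null near each of its points is null, since countably many of the
    neighbourhoods cover it.\<close>
  show ?thesis
    unfolding locally_negligible_alt[of "frontier U"]
  proof
    fix p assume p: "p \<in> frontier U"
    then obtain r where "r > 0" "negligible (frontier U \<inter> ball p r)" using * by blast
    then show "\<exists>V. openin (top_of_set (frontier U)) V \<and> p \<in> V \<and> negligible V"
      using p by (intro exI[of _ "frontier U \<inter> ball p r"]) auto
  qed
qed

text \<open>Nothing is known about derivatives of \<open>h\<close> at the boundary points of
  \<open>S\<close>, so the mean value theorem cannot be applied across them. But \<open>h\<close>
  vanishes at the first and at the last point of \<open>{a..b}\<close> outside \<open>S\<close>, so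
  whatever lies between them cancels; only the two outer intervals, which lie in \<open>S\<close>,
  contribute.\<close>

lemma lipschitz_zero_outside_real:
  fixes h :: "real \<Rightarrow> real"
  assumes "open S" and cont: "continuous_on UNIV h" and zero: "\<And>t. t \<notin> S \<Longrightarrow> h t = 0"
    and der: "\<And>t. t \<in> S \<Longrightarrow> (h has_real_derivative h' t) (at t)"
    and bd: "\<And>t. t \<in> S \<Longrightarrow> \<bar>h' t\<bar> \<le> L" and "L \<ge> 0" and "a \<le> b"
  shows "\<bar>h b - h a\<bar> \<le> L * (b - a)"
proof -
  have piece: "\<bar>h d - h c\<bar> \<le> L * (d - c)" if "c \<le> d" "{c<..<d} \<subseteq> S" for c d
  proof (cases "c = d")
    case False
    have "\<exists>x\<in>{c<..<d}. h d - h c = (\<lambda>y. y * h' x) (d - c)"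
    proof (rule mvt[of c d h "\<lambda>x y. y * h' x"])
      show "continuous_on {c..d} h" using continuous_on_subset[OF cont] by blast
      show "(h has_derivative (\<lambda>y. y * h' x)) (at x)" if "c < x" "x < d" for x
        using der[of x] that \<open>{c<..<d} \<subseteq> S\<close> by (auto simp: has_field_derivative_def mult_commute_abs)
    qed (use that False in auto)
    then obtain x where "x \<in> {c<..<d}" "h d - h c = (d - c) * h' x" by auto
    then show ?thesis
      using bd[of x] that by (auto simp: abs_mult mult.commute intro!: mult_right_mono)
  qed simp
  define C where "C = {a..b} - S"
  show ?thesis
  proof (cases "C = {}")
    case True
    then show ?thesis using piece[OF \<open>a \<le> b\<close>] unfolding C_def by (meson Diff_eq_empty_iff greaterThanLessThan_subseteq_atLeastAtMost_iff order.trans order_refl)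
  next
    case False
    have "compact C" unfolding C_def using \<open>open S\<close> by (intro compact_diff) auto
    obtain c where c: "c \<in> C" "\<forall>x\<in>C. c \<le> x" using compact_attains_inf[OF \<open>compact C\<close> False] by auto
    obtain d where d: "d \<in> C" "\<forall>x\<in>C. x \<le> d" using compact_attains_sup[OF \<open>compact C\<close> False] by auto
    have cd: "c \<le> d" "a \<le> c" "d \<le> b" "h c = 0" "h d = 0" using c d zero by (auto simp: C_def)
    have "x \<in> S" if "a < x" "x < b" "x < c \<or> d < x" for x
    proof (rule ccontr)
      assume "x \<notin> S"
      then have "x \<in> C" using that by (simp add: C_def)
      then show False using c(2) d(2) that by fastforce
    qed
    then have "{a<..<c} \<subseteq> S" "{d<..<b} \<subseteq> S"
      using cd by auto
    then have "\<bar>h c - h a\<bar> \<le> L * (c - a)" "\<bar>h b - h d\<bar> \<le> L * (b - d)"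
      using piece[of a c] piece[of d b] cd(1-3) by auto
    moreover have "L * (c - a) + L * (b - d) \<le> L * (b - a)"
      using cd \<open>L \<ge> 0\<close> by (simp add: distrib_left[symmetric] mult_left_mono)
    ultimately show ?thesis using cd by simp
  qed
qed

text \<open>Restriction to the line through \<open>x\<close> in direction \<open>e\<close>. Only
  this direction enters the bound, which is why bounds for the diagonal entries of a Jacobian
  suffice later.\<close>

lemma lipschitz_zero_outside:
  fixes f :: "'a::euclidean_space \<Rightarrow> real"
  assumes "open U" and cont: "continuous_on UNIV f" and zero: "\<And>x. x \<notin> U \<Longrightarrow> f x = 0"
    and der: "\<And>x. x \<in> U \<Longrightarrow> (f has_derivative f' x) (at x)"
    and bd: "\<And>x. x \<in> U \<Longrightarrow> \<bar>f' x e\<bar> \<le> L" and "L \<ge> 0" and "s \<ge> 0"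
  shows "\<bar>f (x + s *\<^sub>R e) - f x\<bar> \<le> L * s"
proof -
  let ?h = "\<lambda>t. f (x + t *\<^sub>R e)"
  let ?S = "(\<lambda>t. x + t *\<^sub>R e) -` U"
  have "\<bar>?h s - ?h 0\<bar> \<le> L * (s - 0)"
  proof (rule lipschitz_zero_outside_real[where S = ?S and h' = "\<lambda>t. f' (x + t *\<^sub>R e) e"])
    show "open ?S" by (intro open_vimage assms continuous_intros)
    show "continuous_on UNIV ?h"
      by (intro continuous_on_compose2[OF cont] continuous_intros) auto
    fix t assume t: "t \<in> ?S"
    have "((\<lambda>t. x + t *\<^sub>R e) has_derivative (\<lambda>t. t *\<^sub>R e)) (at t)"
      by (auto intro!: derivative_eq_intros)
    moreover have D: "(f has_derivative f' (x + t *\<^sub>R e)) (at (x + t *\<^sub>R e))"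
      using t der by auto
    ultimately have "(?h has_derivative (\<lambda>u. f' (x + t *\<^sub>R e) (u *\<^sub>R e))) (at t)"
      by (rule has_derivative_compose)
    moreover have "(\<lambda>u. f' (x + t *\<^sub>R e) (u *\<^sub>R e)) = (*) (f' (x + t *\<^sub>R e) e)"
      using D has_derivative_linear linear_scale by (fastforce simp: mult.commute)
    ultimately show "(?h has_real_derivative f' (x + t *\<^sub>R e) e) (at t)"
      by (simp add: has_field_derivative_def)
  qed (use assms in auto)
  then show ?thesis by simp
qed

text \<open>By translation invariance every difference quotient has integral zero.\<close>

lemma integral_directional_derivative_eq_0:
  fixes f :: "'a::euclidean_space \<Rightarrow> real"
  assumes U: "open U" "bounded U" "negligible (frontier U)"
    and cont: "continuous_on UNIV f" and zero: "\<And>x. x \<notin> U \<Longrightarrow> f x = 0"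
    and der: "\<And>x. x \<in> U \<Longrightarrow> (f has_derivative f' x) (at x)"
    and bd: "\<And>x. x \<in> U \<Longrightarrow> \<bar>f' x e\<bar> \<le> L"
  shows "set_integrable lborel U (\<lambda>x. f' x e)"
    and "(LINT x:U|lborel. f' x e) = 0"
proof -
  \<comment> \<open>If \<open>U\<close> is empty, \<open>L\<close> may be negative, whereas a
    Lipschitz constant has to be nonnegative.\<close>
  have L0: "\<bar>f' x e\<bar> \<le> max L 0" if "x \<in> U" for x using bd[OF that] by simp
  define c where "c n = 1 / real (Suc n)" for n
  have c: "c n > 0" "c n \<le> 1" for n by (auto simp: c_def)
  have c0: "c \<longlonglongrightarrow> 0" unfolding c_def by (rule LIMSEQ_inverse_real_of_nat[unfolded inverse_eq_divide])
  define q where "q n x = (f (x + c n *\<^sub>R e) - f x) / c n" for n x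
  define g where "g x = indicator U x *\<^sub>R f' x e" for x
  obtain R where R: "\<And>x. x \<in> U \<Longrightarrow> norm x \<le> R" using U(2) by (auto simp: bounded_iff)
  \<comment> \<open>Since \<open>c n \<le> 1\<close> and \<open>f\<close> vanishes outside the ball
    of radius \<open>R\<close>, every quotient vanishes outside \<open>B\<close>; this bounded set
    carries the dominating function.\<close>
  define B where "B = cball (0::'a) (R + norm e)"
  have fB: "f x = 0" if "x \<notin> cball 0 R" for x
    using that R zero by (meson mem_cball_0)
  have intf: "integrable lborel f"
  proof -
    have "integrable lborel (\<lambda>x. indicator (cball 0 R) x *\<^sub>R f x)"
      by (rule borel_integrable_compact) (auto intro: continuous_on_subset[OF cont])
    also have "(\<lambda>x. indicator (cball 0 R) x *\<^sub>R f x) = f"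
      using fB by (auto simp: indicator_def fun_eq_iff)
    finally show ?thesis .
  qed
  have fm [measurable]: "f \<in> borel_measurable borel" using cont by (rule borel_measurable_continuous_onI)
  have trans: "integrable lborel (\<lambda>x. f (x + v))" "(LINT x|lborel. f (x + v)) = (LINT x|lborel. f x)" for v
  proof -
    have "integrable (distr lborel borel ((+) v)) f" using intf by (simp add: lborel_distr_plus)
    then show "integrable lborel (\<lambda>x. f (x + v))" by (subst (asm) integrable_distr_eq) (auto simp: add.commute)
    have "(LINT x|distr lborel borel ((+) v). f x) = (LINT x|lborel. f (v + x))" by (subst integral_distr) auto
    then show "(LINT x|lborel. f (x + v)) = (LINT x|lborel. f x)"
      by (simp add: lborel_distr_plus add.commute)
  qed
  have q_int: "(LINT x|lborel. q n x) = 0" for n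
    unfolding q_def using trans intf by simp
  have q_bd: "norm (q n x) \<le> max L 0 * indicator B x" for n x
  proof (cases "x \<in> B")
    case True
    have "\<bar>f (x + c n *\<^sub>R e) - f x\<bar> \<le> max L 0 * c n"
      by (rule lipschitz_zero_outside[OF U(1) cont zero der L0]) (use c[of n] in auto)
    then show ?thesis using c[of n] True by (simp add: q_def abs_div field_simps)
  next
    case False
    then have nx: "norm x > R + norm e" by (simp add: B_def)
    have "norm (c n *\<^sub>R e) \<le> norm e" using c[of n] by (simp add: mult_left_le_one_le)
    then have "norm (x + c n *\<^sub>R e) > R" using nx norm_diff_ineq[of x "c n *\<^sub>R e"] by linarith
    moreover have "norm x > R" using nx norm_ge_zero[of e] by linarith
    ultimately show ?thesis using fB False by (simp add: q_def)
  qed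
  \<comment> \<open>Inside \<open>U\<close> this is differentiability; outside the closure the
    quotients are eventually zero. Only the frontier escapes, and it is a null set.\<close>
  have q_lim: "(\<lambda>n. q n x) \<longlonglongrightarrow> g x" if "x \<notin> frontier U" for x
  proof (cases "x \<in> U")
    case True
    have "((\<lambda>t. f (x + t *\<^sub>R e)) has_derivative (\<lambda>t. f' x (t *\<^sub>R e))) (at 0)"
      by (rule has_derivative_compose[where f = "\<lambda>t. x + t *\<^sub>R e" and f' = "\<lambda>t. t *\<^sub>R e"])
         (auto intro!: derivative_eq_intros der True)
    moreover have "(\<lambda>t. f' x (t *\<^sub>R e)) = (*) (f' x e)"
      using der[OF True] has_derivative_linear linear_scale by (fastforce simp: mult.commute)
    ultimately have "((\<lambda>t. f (x + t *\<^sub>R e)) has_real_derivative f' x e) (at 0)"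
      by (simp add: has_field_derivative_def)
    then have "((\<lambda>h. (f (x + h *\<^sub>R e) - f x) / h) \<longlongrightarrow> f' x e) (at 0)"
      by (simp add: has_field_derivative_iff)
    moreover have "filterlim c (at 0) sequentially"
      using c0 c by (auto simp: filterlim_at intro!: eventuallyI) (metis less_irrefl)
    ultimately have "((\<lambda>n. (f (x + c n *\<^sub>R e) - f x) / c n) \<longlongrightarrow> f' x e) sequentially"
      by (rule filterlim_compose)
    then show ?thesis using True by (simp add: q_def g_def)
  next
    case False
    with that have "x \<in> - closure U" by (simp add: frontier_def interior_open U(1))
    moreover have "open (- closure U)" by auto
    moreover have "(\<lambda>n. x + c n *\<^sub>R e) \<longlonglongrightarrow> x + 0 *\<^sub>R e"
      by (intro tendsto_intros c0)
    ultimately have "eventually (\<lambda>n. x + c n *\<^sub>R e \<in> - closure U) sequentially"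
      using topological_tendstoD[of "\<lambda>n. x + c n *\<^sub>R e" x sequentially "- closure U"] by simp
    then have "eventually (\<lambda>n. q n x = 0) sequentially"
      by eventually_elim (use False zero closure_subset in \<open>auto simp: q_def\<close>)
    then show ?thesis using False by (simp add: g_def tendsto_eventually)
  qed
  have AE: "AE x in lborel. x \<notin> frontier U"
  proof (rule AE_not_in)
    have "frontier U \<in> sets lborel" by (simp add: borel_closed)
    then show "frontier U \<in> null_sets lborel"
      using U(3) unfolding negligible_iff_null_sets by (simp only: null_sets_completion_iff)
  qed
  have [measurable]: "q n \<in> borel_measurable borel" for n unfolding q_def by measurable
  have gm [measurable]: "g \<in> borel_measurable borel"
  proof (rule borel_measurable_LIMSEQ_real)
    \<comment> \<open>Cut off on the frontier, where \<open>g\<close> vanishes too, the quotients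
      converge at every point, which makes \<open>g\<close> Borel measurable.\<close>
    show "(\<lambda>n. indicator (- frontier U) x * q n x) \<longlonglongrightarrow> g x" for x
      using q_lim[of x] U(1) by (cases "x \<in> frontier U")
        (auto simp: g_def frontier_def interior_open)
    show "(\<lambda>x. indicator (- frontier U) x * q n x) \<in> borel_measurable borel" for n
      by (intro borel_measurable_times borel_measurable_indicator) auto
  qed
  have intB: "integrable lborel (\<lambda>x. max L 0 * indicator B x)"
    unfolding B_def by (intro integrable_mult_right integrable_real_indicator)
       (simp_all add: emeasure_bounded_finite[simplified])
  have limAE: "AE x in lborel. (\<lambda>n. q n x) \<longlonglongrightarrow> g x" using AE by eventually_elim (rule q_lim)
  have meas: "g \<in> borel_measurable lborel" "\<And>n. q n \<in> borel_measurable lborel"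
    using gm \<open>\<And>n. q n \<in> borel_measurable borel\<close> by simp_all
  have "integrable lborel g"
    by (rule integrable_dominated_convergence[OF meas intB limAE]) (rule AE_I2, rule q_bd)
  then show "set_integrable lborel U (\<lambda>x. f' x e)" by (simp add: set_integrable_def g_def[abs_def])
  have "(\<lambda>n. LINT x|lborel. q n x) \<longlonglongrightarrow> (LINT x|lborel. g x)"
    by (rule integral_dominated_convergence[OF meas intB limAE]) (rule AE_I2, rule q_bd)
  then have "(LINT x|lborel. g x) = 0" unfolding q_int by (simp add: LIMSEQ_const_iff)
  then show "(LINT x:U|lborel. f' x e) = 0" by (simp add: set_lebesgue_integral_def g_def[abs_def])
qed

text \<open>Each product \<open>V x $ i * w x\<close> vanishes on the frontier together with
  \<open>w\<close>, so the previous result applies to it in the direction of the i-th axis; the sum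
  over \<open>i\<close> is the divergence of \<open>w V\<close>. \<open>V\<close> itself may be
  arbitrary on the frontier.\<close>

lemma integral_divergence_eq_0:
  fixes U :: "(real^3) set" and V :: "real^3 \<Rightarrow> real^3" and w :: "real^3 \<Rightarrow> real"
  assumes U: "open U" "bounded U" "negligible (frontier U)"
    and V: "continuous_on (closure U) V" "\<And>x. x \<in> U \<Longrightarrow> (V has_derivative V' x) (at x)"
    and w: "continuous_on (closure U) w" "\<And>x. x \<in> U \<Longrightarrow> GDERIV w x :> D x"
    and w0: "\<And>x. x \<in> frontier U \<Longrightarrow> w x = 0"
    and bd: "\<And>x i. x \<in> U \<Longrightarrow> \<bar>V' x (axis i 1) $ i\<bar> \<le> L" "\<And>x. x \<in> U \<Longrightarrow> norm (D x) \<le> L"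
  shows "(LINT x:U|lborel. (\<Sum>i\<in>UNIV. V' x (axis i 1) $ i) * w x + V x \<bullet> D x) = 0"
proof -
  have cU: "compact (closure U)" using U(2) by simp
  obtain B where B: "\<And>x. x \<in> closure U \<Longrightarrow> norm (V x) \<le> B"
    using compact_imp_bounded[OF compact_continuous_image[OF V(1) cU]] by (auto simp: bounded_iff)
  obtain W where W: "\<And>x. x \<in> closure U \<Longrightarrow> \<bar>w x\<bar> \<le> W"
    using compact_imp_bounded[OF compact_continuous_image[OF w(1) cU]] by (auto simp: bounded_iff)
  define f' where "f' i x h = V x $ i * (h \<bullet> D x) + V' x h $ i * w x" for i x h
  have "set_integrable lborel U (\<lambda>x. f' i x (axis i 1)) \<and> (LINT x:U|lborel. f' i x (axis i 1)) = 0" for i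
  proof -
    \<comment> \<open>The closed sets \<open>closure U\<close> and \<open>- U\<close> meet exactly
      in the frontier, where both branches are zero; so the pieces glue to a continuous
      function.\<close>
    define f where "f x = (if x \<in> closure U then V x $ i * w x else 0)" for x
    have "continuous_on (closure U \<union> - U) f"
      unfolding f_def
    proof (rule continuous_on_If)
      show "closed (- U)" using U(1) by (simp add: closed_Compl)
      show "continuous_on (closure U) (\<lambda>x. V x $ i * w x)"
        by (intro continuous_intros V(1) w(1))
      show "V x $ i * w x = 0" if "x \<in> - U" "x \<in> closure U" for x
        using that w0[of x] U(1) by (simp add: frontier_def interior_open)
    qed auto
    moreover have "closure U \<union> - U = UNIV" using closure_subset by auto
    ultimately have cont: "continuous_on UNIV f" by simp
    have zero: "f x = 0" if "x \<notin> U" for x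
      using that w0[of x] U(1) by (auto simp: f_def frontier_def interior_open)
    have der: "(f has_derivative f' i x) (at x)" if x: "x \<in> U" for x
    proof (rule has_derivative_transform_within_open[OF _ U(1) x])
      have "(w has_derivative (\<lambda>h. h \<bullet> D x)) (at x)" using w(2)[OF x] by (simp add: gderiv_def)
      moreover have "((\<lambda>x. V x $ i) has_derivative (\<lambda>h. V' x h $ i)) (at x)"
        using bounded_linear.has_derivative[OF bounded_linear_vec_nth V(2)[OF x]] .
      ultimately show "((\<lambda>x. V x $ i * w x) has_derivative f' i x) (at x)"
        unfolding f'_def by (rule has_derivative_mult[rotated])
      show "V y $ i * w y = f y" if "y \<in> U" for y
        using that closure_subset by (auto simp: f_def)
    qed
    have bound: "\<bar>f' i x (axis i 1)\<bar> \<le> B * L + L * W" if x: "x \<in> U" for x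
    proof -
      have xc: "x \<in> closure U" using x closure_subset by auto
      have "\<bar>V x $ i\<bar> \<le> B" using B[OF xc] component_le_norm_cart[of "V x" i] by linarith
      moreover have "\<bar>D x $ i\<bar> \<le> L" using bd(2)[OF x] component_le_norm_cart[of "D x" i] by linarith
      ultimately have "\<bar>V x $ i * D x $ i\<bar> \<le> B * L" unfolding abs_mult by (intro mult_mono) auto
      moreover have "\<bar>V' x (axis i 1) $ i * w x\<bar> \<le> L * W" unfolding abs_mult
        using bd(1)[OF x, of i] W[OF xc] by (intro mult_mono) auto
      ultimately show ?thesis by (simp add: f'_def inner_axis' )
    qed
    show ?thesis
      using integral_directional_derivative_eq_0[OF U cont zero der bound] by blast
  qed
  note * = this
  have eq: "(\<Sum>i\<in>UNIV. f' i x (axis i 1)) = (\<Sum>i\<in>UNIV. V' x (axis i 1) $ i) * w x + V x \<bullet> D x" for x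
  proof -
    have "V x \<bullet> D x = (\<Sum>i\<in>UNIV. V x $ i * D x $ i)" by (simp add: inner_vec_def)
    then show ?thesis by (simp add: f'_def sum.distrib sum_distrib_right inner_axis')
  qed
  have "(LINT x|lborel. (\<Sum>i\<in>UNIV. indicator U x *\<^sub>R f' i x (axis i 1))) = 0"
    using * by (subst Bochner_Integration.integral_sum) (simp_all add: set_integrable_def set_lebesgue_integral_def)
  then show "(LINT x:U|lborel. (\<Sum>i\<in>UNIV. V' x (axis i 1) $ i) * w x + V x \<bullet> D x) = 0"
    unfolding set_lebesgue_integral_def eq[symmetric] scaleR_sum_right .
qed

section \<open>Derivative operators and integrals over space-time cylinders\<close>

lemma divergence_eq:
  assumes "(V has_derivative V') (at x)"
  shows "divergence V x = (\<Sum>i\<in>UNIV. V' (axis i 1) $ i)"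
proof -
  have "frechet_derivative V (at x) = V'" using frechet_derivative_at[OF assms] by simp
  then show ?thesis by (simp add: divergence_def jacobian_def trace_def matrix_def)
qed

lemma grad_eq:
  assumes "GDERIV f x :> D"
  shows "grad f x = D"
  unfolding grad_def
proof (rule the_equality)
  fix D' assume "GDERIV f x :> D'"
  then have "(\<lambda>h. h \<bullet> D') = (\<lambda>h. h \<bullet> D)"
    using assms has_derivative_unique unfolding gderiv_def by blast
  then show "D' = D" by (metis inner_commute vector_eq_rdot)
qed (rule assms)

lemma time_deriv_eq:
  assumes "(w x has_real_derivative E) (at t within {0..T})" "t \<in> {0..T}" "0 < T"
  shows "time_deriv T w x t = E"
  unfolding time_deriv_def
  using assms by (intro vector_derivative_within_cbox[of 0 T, unfolded cbox_interval] )
    (auto simp: has_real_derivative_iff_has_vector_derivative)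

lemma set_integrable_cylinder:
  fixes h :: "'a::euclidean_space \<times> real \<Rightarrow> real"
  assumes "open U" "bounded U" "continuous_on (closure U \<times> {s..T}) h"
  shows "set_integrable lborel (U \<times> {s..T}) h"
proof (rule set_integrable_subset)
  show "set_integrable lborel (closure U \<times> {s..T}) h"
    unfolding set_integrable_def using assms(2,3)
    by (intro borel_integrable_compact compact_Times) auto
  show "U \<times> {s..T} \<in> sets lborel"
    using assms(1) by (simp add: borel_prod[symmetric])
  show "U \<times> {s..T} \<subseteq> closure U \<times> {s..T}" using closure_subset by auto
qed

text \<open>Both orders occur: time outside for the flux identity, which holds on each time slice,
  and space outside for the fundamental theorem of calculus along \<open>{s..T}\<close>.\<close>

lemma set_integral_cylinder:
  fixes h :: "'a::euclidean_space \<times> real \<Rightarrow> real"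
  assumes "open U" "bounded U" "continuous_on (closure U \<times> {s..T}) h"
  shows "(LINT z:U \<times> {s..T}|lborel. h z) = (LINT t:{s..T}|lborel. LINT x:U|lborel. h (x, t))"
    and "(LINT z:U \<times> {s..T}|lborel. h z) = (LINT x:U|lborel. LINT t:{s..T}|lborel. h (x, t))"
proof -
  have "integrable (lborel \<Otimes>\<^sub>M lborel) (\<lambda>z. indicator (U \<times> {s..T}) z *\<^sub>R h z)"
    using set_integrable_cylinder[OF assms] by (simp add: set_integrable_def lborel_prod)
  then have "integrable (lborel \<Otimes>\<^sub>M lborel) (\<lambda>(x, t). indicator (U \<times> {s..T}) (x, t) *\<^sub>R h (x, t))"
    by (simp add: case_prod_unfold)
  note int = lborel_pair.integral_snd[OF this] lborel_pair.integral_fst[OF this]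
  have "(LINT x|lborel. indicator (U \<times> {s..T}) (x, t) *\<^sub>R h (x, t)) = indicator {s..T} t *\<^sub>R (LINT x:U|lborel. h (x, t))" for t
    by (cases "t \<in> {s..T}") (simp_all add: set_lebesgue_integral_def indicator_times)
  then show "(LINT z:U \<times> {s..T}|lborel. h z) = (LINT t:{s..T}|lborel. LINT x:U|lborel. h (x, t))"
    using int(1) by (simp add: set_lebesgue_integral_def[of lborel "U \<times> {s..T}"]
      set_lebesgue_integral_def[of lborel "{s..T}"] lborel_prod case_prod_unfold)
  have "(LINT t|lborel. indicator (U \<times> {s..T}) (x, t) *\<^sub>R h (x, t)) = indicator U x *\<^sub>R (LINT t:{s..T}|lborel. h (x, t))" for x
    by (cases "x \<in> U") (simp_all add: set_lebesgue_integral_def indicator_times)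
  then show "(LINT z:U \<times> {s..T}|lborel. h z) = (LINT x:U|lborel. LINT t:{s..T}|lborel. h (x, t))"
    using int(2) by (simp add: set_lebesgue_integral_def[of lborel "U \<times> {s..T}"]
      set_lebesgue_integral_def[of lborel U] lborel_prod case_prod_unfold)
qed

text \<open>\<open>h\<close> is continuous only for positive times and may be unbounded near
  \<open>t = 0\<close>. The strips starting at \<open>T / (n + 1)\<close> exhaust the cylinder, and
  a bound \<open>Y\<close> common to all of them survives monotone convergence.\<close>

lemma nn_integral_cylinder_le:
  fixes h :: "'a::euclidean_space \<times> real \<Rightarrow> real"
  assumes U: "open U" "bounded U" and cont: "continuous_on (closure U \<times> {0<..T}) h"
    and nonneg: "\<And>x t. x \<in> U \<Longrightarrow> t \<in> {0<..T} \<Longrightarrow> 0 \<le> h (x, t)"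
    and le: "\<And>s. 0 < s \<Longrightarrow> s \<le> T \<Longrightarrow> (LINT z:U \<times> {s..T}|lborel. h z) \<le> Y"
    and "0 < T"
  shows "(\<integral>\<^sup>+ t \<in> {0<..T}. (\<integral>\<^sup>+ x \<in> U. ennreal (h (x, t)) \<partial>lborel) \<partial>lborel) \<le> ennreal Y"
proof -
  define c where "c n = T / real (Suc n)" for n
  have c: "0 < c n" "c n \<le> T" for n using \<open>0 < T\<close> by (auto simp: c_def field_simps)
  have c0: "c \<longlonglongrightarrow> 0"
    unfolding c_def using LIMSEQ_Suc[OF lim_const_over_n[of T]] .
  define f where "f n z = ennreal (indicator (U \<times> {c n..T}) z *\<^sub>R h z)" for n z
  have contn: "continuous_on (closure U \<times> {c n..T}) h" for n
    using c[of n] by (intro continuous_on_subset[OF cont]) auto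
  have f_int: "integrable lborel (\<lambda>z. indicator (U \<times> {c n..T}) z *\<^sub>R h z)" for n
    using set_integrable_cylinder[OF U contn] by (simp add: set_integrable_def)
  have f_nonneg: "0 \<le> indicator (U \<times> {c n..T}) z *\<^sub>R h z" for n z
    using nonneg[of "fst z" "snd z"] c[of n] by (cases z) (auto simp: indicator_def)
  have f_meas: "f n \<in> borel_measurable (lborel \<Otimes>\<^sub>M lborel)" for n
    unfolding f_def lborel_prod by (rule measurable_compose[OF borel_measurable_integrable[OF f_int]]) simp
  define q where "q n t = (\<integral>\<^sup>+ x. f n (x, t) \<partial>lborel)" for n t
  have q_meas: "q n \<in> borel_measurable lborel" for n
    unfolding q_def using lborel.borel_measurable_nn_integral[of "\<lambda>t x. f n (x, t)" lborel] f_meas[of n]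
    by simp
  have q_le: "(\<integral>\<^sup>+ t. q n t \<partial>lborel) \<le> ennreal Y" for n
  proof -
    have "(\<integral>\<^sup>+ t. q n t \<partial>lborel) = integral\<^sup>N lborel (f n)"
      unfolding q_def using lborel_pair.nn_integral_snd[OF f_meas[of n]] by (simp add: lborel_prod)
    also have "\<dots> = ennreal (LINT z:U \<times> {c n..T}|lborel. h z)"
      unfolding f_def set_lebesgue_integral_def
      by (rule nn_integral_eq_integral[OF f_int]) (use f_nonneg in auto)
    also have "\<dots> \<le> ennreal Y" using le[OF c] by (rule ennreal_leI)
    finally show ?thesis .
  qed
  have q_eq: "q n t = (\<integral>\<^sup>+ x \<in> U. ennreal (h (x, t)) \<partial>lborel) * indicator {c n..T} t" for n t
    by (auto simp: q_def f_def indicator_def intro!: nn_integral_cong)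
  have "(\<integral>\<^sup>+ t \<in> {0<..T}. (\<integral>\<^sup>+ x \<in> U. ennreal (h (x, t)) \<partial>lborel) \<partial>lborel) = (\<integral>\<^sup>+ t. (SUP n. q n t) \<partial>lborel)"
  proof (rule nn_integral_cong)
    fix t
    have "(SUP n. indicator {c n..T} t) = (indicator {0<..T} t :: ennreal)"
    proof (cases "t \<in> {0<..T}")
      case True
      then have "eventually (\<lambda>n. c n < t) sequentially" using c0 by (auto dest: order_tendstoD)
      then obtain n where "c n < t" by (auto simp: eventually_sequentially)
      then have "indicator {c n..T} t = (1 :: ennreal)" using True by simp
      then have "(SUP n. indicator {c n..T} t) = (1 :: ennreal)"
        by (intro antisym SUP_least) (auto simp: indicator_def intro: SUP_upper2[of n])
      then show ?thesis using True by simp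
    next
      case False
      then have "indicator {c n..T} t = (0 :: ennreal)" for n using c(1)[of n] by (auto simp: indicator_def)
      then show ?thesis using False by simp
    qed
    then show "(\<integral>\<^sup>+ x \<in> U. ennreal (h (x, t)) \<partial>lborel) * indicator {0<..T} t = (SUP n. q n t)"
      unfolding q_eq by (simp add: SUP_mult_left_ennreal[symmetric])
  qed
  also have "\<dots> = (SUP n. \<integral>\<^sup>+ t. q n t \<partial>lborel)"
  proof (rule nn_integral_monotone_convergence_SUP)
    have "c (Suc n) \<le> c n" for n
      using \<open>0 < T\<close> by (simp add: c_def frac_le)
    then show "incseq q"
      unfolding q_eq[abs_def] by (intro incseq_SucI le_funI mult_left_mono) (auto simp: indicator_def intro: order_trans)
  qed (use q_meas in simp)
  also have "\<dots> \<le> ennreal Y" using q_le by (rule SUP_least)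
  finally show ?thesis .
qed

section \<open>The inverse of the Forchheimer map\<close>

lemma linear_cross3: "linear (cross3 k)"
  by (intro linearI cross_add_right cross_mult_right)

lemma Jmat_mult: "Jmat k *v x = cross3 k x"
  using linear_cross3[of k] by (simp add: Jmat_def matrix_works)

lemma norm_cross3_le: "norm (cross3 k x) \<le> norm k * norm x"
proof -
  have "(norm (cross3 k x))\<^sup>2 \<le> (norm k * norm x)\<^sup>2"
    using norm_cross_dot[of k x] by (smt (verit) zero_le_power2)
  then show ?thesis by (rule power2_le_imp_le) simp
qed

text \<open>For \<open>p < 1\<close> the factor \<open>norm v powr (p - 1)\<close> is singular at
  the origin. There the conventions \<open>0 powr p = 0\<close> and \<open>sgn 0 = 0\<close> turn
  the formula into the zero map, which is the correct derivative because the function is of order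
  \<open>1 + p\<close>.\<close>

lemma has_derivative_norm_powr_scaleR:
  fixes v :: "'a::real_inner"
  assumes "p > 0"
  shows "((\<lambda>v. norm v powr p *\<^sub>R v) has_derivative
    (\<lambda>h. norm v powr p *\<^sub>R h + (p * norm v powr (p - 1) * (h \<bullet> sgn v)) *\<^sub>R v)) (at v)"
proof (cases "v = 0")
  case False
  have "(norm has_derivative (\<lambda>h. h \<bullet> sgn v)) (at v)"
    using has_derivative_norm[OF False] by (simp add: inner_commute)
  moreover have "((\<lambda>s. s powr p) has_derivative (\<lambda>s. s * (p * norm v powr (p - 1)))) (at (norm v))"
    using has_real_derivative_powr[of "norm v" p] False
    by (simp add: has_field_derivative_def mult_commute_abs)
  ultimately have "((\<lambda>v. norm v powr p) has_derivative (\<lambda>h. (h \<bullet> sgn v) * (p * norm v powr (p - 1)))) (at v)"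
    by (rule has_derivative_compose)
  then show ?thesis
    by (rule has_derivative_eq_rhs[OF has_derivative_scaleR[OF _ has_derivative_ident]]) (simp add: mult_ac)
next
  case True
  have "((\<lambda>h::'a. norm h powr p) \<longlongrightarrow> 0) (at 0)"
    using assms by (auto intro!: tendsto_eq_intros)
  then have "((\<lambda>h::'a. norm (norm h powr p *\<^sub>R h) / norm h) \<longlongrightarrow> 0) (at 0)"
    by (rule Lim_transform_eventually) (auto simp: eventually_at_filter)
  then show ?thesis
    using True assms by (simp add: has_derivative_at)
qed

section \<open>Growth of g and invertibility of F\<close>

locale forchheimer =
  fixes N :: nat and a \<alpha> :: "nat \<Rightarrow> real"
  assumes N: "N \<ge> 1" and \<alpha>0: "\<alpha> 0 = 0" and \<alpha>_Suc: "\<forall>i<N. \<alpha> i < \<alpha> (Suc i)"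
    and a_pos: "\<forall>i\<le>N. a i > 0"
begin

lemma \<alpha>_le: "i \<le> j \<Longrightarrow> j \<le> N \<Longrightarrow> \<alpha> i \<le> \<alpha> j"
proof (induction j rule: dec_induct)
  case (step n)
  then show ?case using \<alpha>_Suc by (smt (verit) Suc_le_lessD order.strict_implies_order)
qed simp

lemma \<alpha>_pos: "1 \<le> i \<Longrightarrow> i \<le> N \<Longrightarrow> \<alpha> i > 0"
  using \<alpha>_le[of 1 i] \<alpha>_Suc \<alpha>0 N by (metis One_nat_def less_le_trans less_eq_Suc_le)

lemma a0_pos: "a 0 > 0" using a_pos by simp

abbreviation g where "g \<equiv> gfun N a \<alpha>"

lemma g_mono: "0 \<le> s \<Longrightarrow> s \<le> t \<Longrightarrow> g s \<le> g t"
  unfolding gfun_def using a_pos \<alpha>_pos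
  by (intro add_left_mono sum_mono mult_left_mono powr_mono2) (auto intro: less_imp_le)

lemma g_ge_a0: "a 0 \<le> g s"
  unfolding gfun_def using a_pos by (auto intro!: sum_nonneg simp: less_imp_le)

lemma g_upper: "0 \<le> s \<Longrightarrow> g s \<le> sum a {0..N} * (1 + s) powr \<alpha> N"
proof -
  assume s: "0 \<le> s"
  have "s powr \<alpha> i \<le> (1 + s) powr \<alpha> N" if "i \<in> {1..N}" for i
  proof -
    have "s powr \<alpha> i \<le> (1 + s) powr \<alpha> i" using s \<alpha>_pos[of i] that by (intro powr_mono2) auto
    also have "\<dots> \<le> (1 + s) powr \<alpha> N" using s \<alpha>_le[of i N] that by (intro powr_mono) auto
    finally show ?thesis .
  qed
  then have "(\<Sum>i = 1..N. a i * s powr \<alpha> i) \<le> (\<Sum>i = 1..N. a i * (1 + s) powr \<alpha> N)"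
    using a_pos by (intro sum_mono mult_left_mono) (auto intro: less_imp_le)
  moreover have "a 0 \<le> a 0 * (1 + s) powr \<alpha> N"
    using s a0_pos \<alpha>_pos[of N] N ge_one_powr_ge_zero[of "1 + s" "\<alpha> N"] by simp
  ultimately show ?thesis
    by (simp add: gfun_def sum.atLeast_Suc_atMost[of 0 N a] distrib_right sum_distrib_right)
qed

text \<open>The factor \<open>2 powr \<alpha> N\<close> in \<open>m\<close> permits working with
  \<open>(1 + s) / 2\<close>: it is at most 1 for \<open>s \<le> 1\<close>, where \<open>a 0\<close>
  suffices, and at most \<open>s\<close> for \<open>s > 1\<close>, where the top term does.\<close>

lemma g_lower: "\<exists>m>0. \<forall>s\<ge>0. m * (1 + s) powr \<alpha> N \<le> g s"
proof -
  define p where "p = \<alpha> N"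
  have p: "p > 0" using \<alpha>_pos N by (simp add: p_def)
  define m where "m = min (a 0) (a N) / 2 powr p"
  have aN: "a N > 0" using a_pos by simp
  have "m * (1 + s) powr p \<le> g s" if s: "s \<ge> 0" for s
  proof -
    have eq: "m * (1 + s) powr p = min (a 0) (a N) * ((1 + s) / 2) powr p"
      using s by (simp add: m_def powr_divide)
    show ?thesis
    proof (cases "s \<le> 1")
      case True
      then have "((1 + s) / 2) powr p \<le> 1" using s p powr_mono2[of p "(1 + s)/2" 1] by simp
      then have "min (a 0) (a N) * ((1 + s) / 2) powr p \<le> a 0 * 1"
        using a0_pos aN by (intro mult_mono) auto
      then show ?thesis using g_ge_a0[of s] eq by simp
    next
      case False
      then have "((1 + s) / 2) powr p \<le> s powr p" using p by (intro powr_mono2) auto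
      then have "min (a 0) (a N) * ((1 + s) / 2) powr p \<le> a N * s powr p"
        using a0_pos aN by (intro mult_mono) auto
      also have "\<dots> \<le> (\<Sum>i = 1..N. a i * s powr \<alpha> i)"
        unfolding p_def using N a_pos
        by (intro member_le_sum[of N "{1..N}" "\<lambda>i. a i * s powr \<alpha> i"]) (auto intro: less_imp_le)
      finally show ?thesis using eq a0_pos by (simp add: gfun_def)
    qed
  qed
  moreover have "m > 0" using a0_pos aN by (simp add: m_def)
  ultimately show ?thesis unfolding p_def by blast
qed

definition F where "F R k v = g (norm v) *\<^sub>R v + R *\<^sub>R cross3 k v"

lemma Fmap_eq: "Fmap N a \<alpha> R k = F R k"
  by (simp add: fun_eq_iff Fmap_def F_def Jmat_mult)

text \<open>The cross product is skew and disappears, so the constant does not depend on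
  \<open>R\<close>. After \<open>a 0\<close> is split off, the rest has the form
  \<open>A v - B w\<close> with nonnegative coefficients; Cauchy-Schwarz reduces it to the lengths,
  where it is the monotonicity of \<open>(g s - a 0) * s\<close>.\<close>

lemma F_monotone: "a 0 * (norm (v - w))\<^sup>2 \<le> (F R k v - F R k w) \<bullet> (v - w)"
proof -
  let ?s = "norm v" and ?r = "norm w"
  let ?A = "g ?s - a 0" and ?B = "g ?r - a 0"
  have A: "?A \<ge> 0" "?B \<ge> 0" using g_ge_a0 by simp_all
  have cr: "(cross3 k v - cross3 k w) \<bullet> (v - w) = 0"
    by (simp add: dot_cross_self flip: Cross3.right_diff_distrib)
  have "0 \<le> (?A * ?s - ?B * ?r) * (?s - ?r)"
  proof (cases "?s \<le> ?r")
    case True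
    then have "?A \<le> ?B" using g_mono by simp
    then have "?A * ?s \<le> ?B * ?r" using True A by (intro mult_mono) auto
    then show ?thesis using True by (simp add: mult_nonpos_nonpos)
  next
    case False
    then have "?B \<le> ?A" using g_mono[of ?r ?s] by simp
    then have "?B * ?r \<le> ?A * ?s" using False A by (intro mult_mono) auto
    then show ?thesis using False by simp
  qed
  also have "\<dots> = ?A * ?s\<^sup>2 + ?B * ?r\<^sup>2 - (?A + ?B) * (?s * ?r)"
    by (simp add: algebra_simps power2_eq_square)
  also have "\<dots> \<le> ?A * ?s\<^sup>2 + ?B * ?r\<^sup>2 - (?A + ?B) * (v \<bullet> w)"
    using A norm_cauchy_schwarz[of v w] by (simp add: mult_left_mono)
  also have "\<dots> = (?A *\<^sub>R v - ?B *\<^sub>R w) \<bullet> (v - w)"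
    by (simp add: power2_norm_eq_inner algebra_simps inner_commute)
  finally have "0 \<le> (?A *\<^sub>R v - ?B *\<^sub>R w) \<bullet> (v - w)" .
  moreover have "F R k v - F R k w = (?A *\<^sub>R v - ?B *\<^sub>R w) + a 0 *\<^sub>R (v - w) + R *\<^sub>R (cross3 k v - cross3 k w)"
    by (simp add: F_def algebra_simps)
  ultimately show ?thesis
    using cr by (simp add: inner_add_left power2_norm_eq_inner)
qed

text \<open>Source of injectivity, of the closed range, and of the Lipschitz constant
  \<open>1 / a 0\<close> of the inverse, all uniform in \<open>R\<close> and
  \<open>k\<close>.\<close>

lemma F_expansive: "a 0 * norm (v - w) \<le> norm (F R k v - F R k w)"
proof (cases "v = w")
  case False
  have "(F R k v - F R k w) \<bullet> (v - w) \<le> norm (F R k v - F R k w) * norm (v - w)"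
    by (rule norm_cauchy_schwarz)
  with F_monotone[of v w R k] have "(a 0 * norm (v - w)) * norm (v - w) \<le> norm (F R k v - F R k w) * norm (v - w)"
    by (simp add: power2_eq_square)
  then show ?thesis using False by (simp add: mult_le_cancel_right)
qed simp

text \<open>Each power term has a positive semidefinite derivative and the rotation a skew one, so
  \<open>a 0\<close> times the identity remains as a lower bound.\<close>

lemma F_has_derivative:
  "\<exists>F'. (F R k has_derivative F') (at v) \<and> (\<forall>h. a 0 * (norm h)\<^sup>2 \<le> F' h \<bullet> h)"
proof -
  define D where "D p h = norm v powr p *\<^sub>R h + (p * norm v powr (p - 1) * (h \<bullet> sgn v)) *\<^sub>R v" for p and h :: "real^3"
  have D_nonneg: "D p h \<bullet> h \<ge> 0" if "p > 0" for p h
  proof -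
    have "(h \<bullet> sgn v) * (v \<bullet> h) \<ge> 0"
      by (simp add: sgn_div_norm inner_commute[of v] mult.assoc)
    then have "p * norm v powr (p - 1) * ((h \<bullet> sgn v) * (v \<bullet> h)) \<ge> 0"
      using that by (intro mult_nonneg_nonneg[of "p * norm v powr (p - 1)"]) auto
    then show ?thesis by (simp add: D_def inner_add_left mult_ac)
  qed
  let ?F' = "\<lambda>h. a 0 *\<^sub>R h + (\<Sum>i = 1..N. a i *\<^sub>R D (\<alpha> i) h) + R *\<^sub>R cross3 k h"
  have eq: "F R k = (\<lambda>v. a 0 *\<^sub>R v + (\<Sum>i = 1..N. a i *\<^sub>R (norm v powr \<alpha> i *\<^sub>R v)) + R *\<^sub>R cross3 k v)"
    by (simp add: fun_eq_iff F_def gfun_def scaleR_add_left scaleR_sum_left)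
  have "((\<lambda>v. a 0 *\<^sub>R v + (\<Sum>i = 1..N. a i *\<^sub>R (norm v powr \<alpha> i *\<^sub>R v)) + R *\<^sub>R cross3 k v)
      has_derivative ?F') (at v)"
  proof (intro has_derivative_add has_derivative_scaleR_right has_derivative_sum has_derivative_ident)
    show "((\<lambda>v. norm v powr \<alpha> i *\<^sub>R v) has_derivative D (\<alpha> i)) (at v)" if "i \<in> {1..N}" for i
      using has_derivative_norm_powr_scaleR[of "\<alpha> i" v] \<alpha>_pos that unfolding D_def by auto
    show "(cross3 k has_derivative cross3 k) (at v)"
      using linear_cross3 linear_conv_bounded_linear bounded_linear_imp_has_derivative by blast
  qed
  moreover have "a 0 * (norm h)\<^sup>2 \<le> ?F' h \<bullet> h" for h
  proof -
    have "(\<Sum>i = 1..N. a i *\<^sub>R D (\<alpha> i) h) \<bullet> h \<ge> 0"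
      unfolding inner_sum_left using D_nonneg a_pos \<alpha>_pos
      by (intro sum_nonneg) (simp add: less_imp_le)
    then show ?thesis by (simp add: inner_add_left power2_norm_eq_inner dot_cross_self)
  qed
  ultimately show ?thesis unfolding eq by blast
qed

lemma F_continuous: "continuous_on UNIV (F R k)"
  by (meson F_has_derivative continuous_at_imp_continuous_on has_derivative_continuous)

lemma F_inj: "inj (F R k)"
proof (rule injI)
  fix v w assume "F R k v = F R k w"
  then have "a 0 * norm (v - w) \<le> 0" using F_expansive[of v w R k] by simp
  then show "v = w" using a0_pos by (simp add: mult_le_0_iff)
qed

text \<open>The range is open by invariance of domain, and closed because by expansiveness the
  preimages of a convergent sequence form a Cauchy sequence; connectedness does the rest.\<close>

lemma F_surj: "surj (F R k)"
proof -
  have "open (range (F R k))"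
    using invariance_of_domain[OF F_continuous open_UNIV] F_inj by blast
  moreover have "closed (range (F R k))"
  proof (unfold closed_sequential_limits, intro allI impI, elim conjE)
    fix y l assume y: "\<forall>n::nat. y n \<in> range (F R k)" and l: "y \<longlonglongrightarrow> l"
    define v where "v n = inv (F R k) (y n)" for n
    have v: "y n = F R k (v n)" for n using y by (simp add: v_def f_inv_into_f)
    have "Cauchy v"
    proof (rule metric_CauchyI)
      fix e :: real assume "e > 0"
      then have "a 0 * e > 0" using a0_pos by simp
      then obtain M where M: "\<And>m n. m \<ge> M \<Longrightarrow> n \<ge> M \<Longrightarrow> dist (y m) (y n) < a 0 * e"
        using metric_CauchyD[OF LIMSEQ_imp_Cauchy[OF l]] by blast
      have "dist (v m) (v n) < e" if "m \<ge> M" "n \<ge> M" for m n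
      proof -
        have "a 0 * norm (v m - v n) < a 0 * e"
          using F_expansive[of "v m" "v n" R k] M[OF that] unfolding v dist_norm by linarith
        then show ?thesis using a0_pos by (simp add: dist_norm)
      qed
      then show "\<exists>M. \<forall>m\<ge>M. \<forall>n\<ge>M. dist (v m) (v n) < e" by blast
    qed
    then obtain w where "v \<longlonglongrightarrow> w" using Cauchy_convergent convergent_def by blast
    then have "(\<lambda>n. F R k (v n)) \<longlonglongrightarrow> F R k w"
      using continuous_on_tendsto_compose[OF F_continuous, of v w] by simp
    then have "y \<longlonglongrightarrow> F R k w" by (simp flip: v)
    then show "l \<in> range (F R k)" using l LIMSEQ_unique by blast
  qed
  ultimately show ?thesis using clopen by blast
qed

definition X where "X R k = inv (F R k)"

lemma Xmap_eq: "Xmap N a \<alpha> R k = X R k"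
  by (simp add: Xmap_def X_def Fmap_eq)

lemma F_X [simp]: "F R k (X R k y) = y"
  unfolding X_def by (simp add: F_surj surj_f_inv_f)

lemma X_continuous: "continuous_on UNIV (X R k)"
proof (rule continuous_on_iff[THEN iffD2], intro ballI allI impI)
  fix y :: "real^3" and e :: real assume "e > 0"
  have "dist (X R k z) (X R k y) < e" if "dist z y < a 0 * e" for z
  proof -
    have "a 0 * dist (X R k z) (X R k y) < a 0 * e"
      using F_expansive[of "X R k z" "X R k y" R k] that by (simp add: dist_norm)
    then show ?thesis using a0_pos by simp
  qed
  then show "\<exists>d>0. \<forall>z\<in>UNIV. dist z y < d \<longrightarrow> dist (X R k z) (X R k y) < e"
    using \<open>e > 0\<close> a0_pos by (intro exI[of _ "a 0 * e"]) auto
qed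

text \<open>Coercivity makes \<open>F'\<close> injective, hence invertible in finite dimension, and
  bounds its inverse. The bound keeps the divergence of the flux bounded on a time slice, as
  integration by parts demands.\<close>

lemma X_has_derivative:
  "\<exists>X'. (X R k has_derivative X') (at y) \<and> (\<forall>h. norm (X' h) \<le> norm h / a 0)"
proof -
  obtain F' where F': "(F R k has_derivative F') (at (X R k y))"
    and pos: "\<And>h. a 0 * (norm h)\<^sup>2 \<le> F' h \<bullet> h"
    using F_has_derivative by blast
  have lin: "linear F'" using F' has_derivative_linear by blast
  have low: "a 0 * norm h \<le> norm (F' h)" for h
  proof (cases "h = 0")
    case False
    have "a 0 * norm h * norm h \<le> norm (F' h) * norm h"
      using pos[of h] norm_cauchy_schwarz[of "F' h" h] by (simp add: power2_eq_square)
    then show ?thesis using False by (simp add: mult_le_cancel_right)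
  qed simp
  have "inj F'"
  proof (rule linear_injective_0[THEN iffD2, OF lin], intro allI impI)
    fix h assume "F' h = 0"
    then have "a 0 * norm h \<le> 0" using low[of h] by simp
    then show "h = 0" using a0_pos by (simp add: mult_le_0_iff)
  qed
  then obtain X' where X': "linear X'" "X' \<circ> F' = id"
    using linear_injective_left_inverse[OF lin] by blast
  have FX': "F' (X' h) = h" for h
    using X' lin by (metis linear_inverse_left o_apply id_apply)
  have "(X R k has_derivative X') (at y)"
  proof (rule has_derivative_inverse_basic[where f = "F R k" and T = UNIV and f' = F'])
    show "bounded_linear X'" using X'(1) linear_conv_bounded_linear by blast
    show "isCont (X R k) y" using X_continuous by (simp add: continuous_on_eq_continuous_at)
  qed (use F' X'(2) in auto)
  moreover have "norm (X' h) \<le> norm h / a 0" for h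
    using low[of "X' h"] a0_pos by (simp add: FX' field_simps)
  ultimately show ?thesis by blast
qed

section \<open>Growth and coercivity of the inverse\<close>

definition \<beta> where "\<beta> = \<alpha> N / (1 + \<alpha> N)"

lemma \<beta>: "0 < \<beta>" "\<beta> < 1"
  using \<alpha>_pos[of N] N by (auto simp: \<beta>_def)

lemma inner_F: "F R k v \<bullet> v = g (norm v) * (norm v)\<^sup>2"
  by (simp add: F_def inner_add_left power2_norm_eq_inner dot_cross_self)

lemma norm_F_lower: "g (norm v) * norm v \<le> norm (F R k v)"
proof (cases "v = 0")
  case False
  have "g (norm v) * norm v * norm v \<le> norm (F R k v) * norm v"
    using inner_F[of R k v] norm_cauchy_schwarz[of "F R k v" v] by (simp add: power2_eq_square)
  then show ?thesis using False by (simp add: mult_le_cancel_right)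
qed (simp add: F_def)

lemma norm_F_upper:
  assumes "norm k = 1" "0 \<le> R"
  shows "norm (F R k v) \<le> (g (norm v) + R) * norm v"
proof -
  have "norm (F R k v) \<le> norm (g (norm v) *\<^sub>R v) + norm (R *\<^sub>R cross3 k v)"
    unfolding F_def by (rule norm_triangle_ineq)
  also have "\<dots> \<le> g (norm v) * norm v + R * norm v"
    using g_ge_a0[of "norm v"] a0_pos assms norm_cross3_le[of k v] by (simp add: mult_left_mono)
  finally show ?thesis by (simp add: distrib_right)
qed

text \<open>Since \<open>Y * (1 + Y) powr - \<beta>\<close> is increasing in \<open>Y\<close>, the lower bound for \<open>|F v|\<close> alone gives
  a bound that does not involve the rotation constant.\<close>

lemma X_upper:
  "\<exists>c>0. \<forall>R k y. norm (X R k y) \<le> c * ((1 + norm y) powr - \<beta> * norm y)"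
proof -
  define p where "p = \<alpha> N"
  have p: "p > 0" using \<alpha>_pos N by (simp add: p_def)
  have b: "\<beta> = p / (1 + p)" by (simp add: \<beta>_def p_def)
  obtain m where m: "m > 0" and lower: "\<And>s. s \<ge> 0 \<Longrightarrow> m * (1 + s) powr p \<le> g s"
    using g_lower unfolding p_def by blast
  define c where "c = (1 + m) powr \<beta> / m"
  have "norm (X R k y) \<le> c * ((1 + norm y) powr - \<beta> * norm y)" for R k y
  proof (cases "X R k y = 0")
    case True
    then show ?thesis using m by (simp add: c_def)
  next
    case False
    define s where "s = norm (X R k y)"
    define Y where "Y = norm y"
    define q where "q = m * (1 + s) powr p * s"
    have s: "s > 0" using False by (simp add: s_def)
    have q: "q > 0" using m s by (simp add: q_def)
    have "q \<le> g s * s" unfolding q_def using lower[of s] s by (intro mult_right_mono) auto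
    also have "\<dots> \<le> Y" using norm_F_lower[of "X R k y" R k] by (simp add: s_def Y_def)
    finally have qY: "q \<le> Y" .
    \<comment> \<open>From \<open>0 < q \<le> Y\<close> follows
      \<open>(1 + Y) / (1 + q) \<le> Y / q\<close>, and \<open>Y / q\<close> is at least 1, so its
      exponent may be raised from \<open>\<beta>\<close> to 1.\<close>
    have "((1 + Y) / (1 + q)) powr \<beta> \<le> (Y / q) powr \<beta>"
      using q qY \<beta> by (intro powr_mono2) (auto simp: field_simps)
    also have "\<dots> \<le> (Y / q) powr 1"
      using q qY \<beta> by (intro powr_mono) (auto simp: field_simps)
    finally have 1: "(1 + Y) powr \<beta> * q \<le> Y * (1 + q) powr \<beta>"
      using q qY by (simp add: powr_divide field_simps)
    \<comment> \<open>The exponent is chosen because \<open>(1 + p) * \<beta> = p\<close>: after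
      taking the power \<open>\<beta>\<close>, the power of \<open>1 + s\<close> cancels against the
      one in \<open>q\<close>, and \<open>s\<close> remains.\<close>
    have "1 + q \<le> (1 + s) powr (1 + p) + m * (1 + s) powr (1 + p)"
    proof (rule add_mono)
      show "1 \<le> (1 + s) powr (1 + p)" using s p ge_one_powr_ge_zero[of "1 + s" "1 + p"] by simp
      have "q \<le> m * (1 + s) powr p * (1 + s)" unfolding q_def using m s by (intro mult_left_mono) auto
      then show "q \<le> m * (1 + s) powr (1 + p)" using s by (simp add: powr_add mult_ac)
    qed
    then have "(1 + q) powr \<beta> \<le> ((1 + m) * (1 + s) powr (1 + p)) powr \<beta>"
      using q \<beta> by (intro powr_mono2) (auto simp: distrib_right)
    also have "\<dots> = (1 + m) powr \<beta> * (1 + s) powr p"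
      using m s p by (simp add: powr_mult powr_powr b)
    finally have "Y * (1 + q) powr \<beta> \<le> Y * ((1 + m) powr \<beta> * (1 + s) powr p)"
      using q qY by (intro mult_left_mono) auto
    with 1 have "(1 + s) powr p * ((1 + Y) powr \<beta> * m * s) \<le> (1 + s) powr p * (Y * (1 + m) powr \<beta>)"
      by (simp add: q_def mult_ac)
    then have "(1 + Y) powr \<beta> * m * s \<le> Y * (1 + m) powr \<beta>"
      using s by (simp add: mult_le_cancel_left)
    then have "s \<le> c * ((1 + Y) powr - \<beta> * Y)"
      using m q qY by (simp add: c_def powr_minus field_simps)
    then show ?thesis by (simp add: s_def Y_def)
  qed
  moreover have "c > 0" using m by (simp add: c_def)
  ultimately show ?thesis by blast
qed

text \<open>With \<open>s\<close> the length of \<open>X R k y\<close>, the rotation does not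
  contribute to \<open>X R k y \<bullet> y = g s * s^2\<close>, but it enlarges \<open>y\<close>, at
  most to length \<open>(g s + R) * s\<close>. As \<open>R \<le> \<kappa>\<close> and
  \<open>g s \<ge> a 0\<close>, this is at most a constant times \<open>\<kappa> * g s * s\<close>.
  Squaring produces the factor \<open>\<kappa>^2\<close> and one surplus \<open>g s\<close>, which
  the upper growth bound turns into \<open>(1 + norm y) powr \<beta>\<close>.\<close>

lemma X_lower:
  "\<exists>c>0. \<forall>R k \<kappa> y. norm k = 1 \<longrightarrow> 0 \<le> R \<longrightarrow> R \<le> \<kappa> \<longrightarrow> 1 \<le> \<kappa> \<longrightarrow>
     c * ((1 + norm y) powr - \<beta> * (norm y)\<^sup>2) \<le> \<kappa>\<^sup>2 * (X R k y \<bullet> y)"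
proof -
  define p where "p = \<alpha> N"
  have p: "p > 0" using \<alpha>_pos N by (simp add: p_def)
  have b: "\<beta> = p / (1 + p)" by (simp add: \<beta>_def p_def)
  obtain m where m: "m > 0" and lower: "\<And>s. s \<ge> 0 \<Longrightarrow> m * (1 + s) powr p \<le> g s"
    using g_lower unfolding p_def by blast
  define A where "A = sum a {0..N}"
  have A: "A > 0" unfolding A_def using a_pos by (intro sum_pos) auto
  define B where "B = 2 powr (1 + p) + 2 / m"
  have B: "B > 0" using m by (simp add: B_def add_pos_pos)
  define D where "D = A * B powr \<beta> * (1 + 1 / a 0)\<^sup>2"
  have D: "D > 0" unfolding D_def using A B a0_pos by (intro mult_pos_pos zero_less_power add_pos_pos) auto
  have "(1 / D) * ((1 + norm y) powr - \<beta> * (norm y)\<^sup>2) \<le> \<kappa>\<^sup>2 * (X R k y \<bullet> y)"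
    if k: "norm k = 1" and R: "0 \<le> R" "R \<le> \<kappa>" "1 \<le> \<kappa>" for R k \<kappa> y
  proof -
    define v where "v = X R k y"
    define s where "s = norm v"
    define Y where "Y = norm y"
    have Fv: "F R k v = y" by (simp add: v_def)
    have s: "s \<ge> 0" "Y \<ge> 0" by (auto simp: s_def Y_def)
    have gs: "g s > 0" using g_ge_a0[of s] a0_pos by simp
    have "m * (1 + s) powr p * s \<le> g s * s" using lower[of s] s by (intro mult_right_mono) auto
    also have "\<dots> \<le> Y" using norm_F_lower[of v R k] by (simp add: Fv s_def Y_def)
    finally have mY: "m * (1 + s) powr p * s \<le> Y" .
    \<comment> \<open>\<open>B\<close> collects two cases: small \<open>s\<close>, where the power
      is bounded, and \<open>s > 1\<close>, where \<open>1 + s \<le> 2 * s\<close> and the lower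
      growth bound of \<open>g\<close> applies.\<close>
    have sB: "(1 + s) powr (1 + p) \<le> B * (1 + Y)"
    proof (cases "s \<le> 1")
      case True
      then have "(1 + s) powr (1 + p) \<le> 2 powr (1 + p)" using s p by (intro powr_mono2) auto
      also have "\<dots> \<le> B * 1" using m by (simp add: B_def)
      also have "\<dots> \<le> B * (1 + Y)" using B s by (intro mult_left_mono) auto
      finally show ?thesis .
    next
      case False
      have "m * (1 + s) powr (1 + p) = m * (1 + s) powr p * (1 + s)" using s by (simp add: powr_add mult_ac)
      also have "\<dots> \<le> m * (1 + s) powr p * (2 * s)" using False m by (intro mult_left_mono) auto
      also have "\<dots> \<le> 2 * Y" using mY by simp
      finally have "(1 + s) powr (1 + p) \<le> 2 / m * Y" using m by (simp add: field_simps)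
      also have "\<dots> \<le> B * (1 + Y)" using m s by (intro mult_mono) (auto simp: B_def)
      finally show ?thesis .
    qed
    have "(1 + s) powr p = ((1 + s) powr (1 + p)) powr \<beta>"
      using p by (simp add: b powr_powr)
    also have "\<dots> \<le> (B * (1 + Y)) powr \<beta>" using sB \<beta> by (intro powr_mono2) auto
    also have "\<dots> = B powr \<beta> * (1 + Y) powr \<beta>" using B s by (simp add: powr_mult)
    finally have "A * (1 + s) powr p \<le> A * (B powr \<beta> * (1 + Y) powr \<beta>)"
      using A by (intro mult_left_mono) auto
    with g_upper[of s] s have gB: "g s \<le> A * B powr \<beta> * (1 + Y) powr \<beta>"
      by (simp add: A_def p_def mult_ac)
    \<comment> \<open>Since \<open>g s \<ge> a 0\<close>, the rotation constant is absorbed into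
      \<open>g s\<close> at the price of a factor \<open>\<kappa> / a 0\<close>.\<close>
    have "R * a 0 \<le> \<kappa> * g s" using R g_ge_a0[of s] a0_pos by (intro mult_mono) auto
    then have "R \<le> \<kappa> * g s / a 0" using a0_pos by (simp add: field_simps)
    moreover have "g s \<le> \<kappa> * g s" using R gs by simp
    ultimately have "g s + R \<le> g s * \<kappa> * (1 + 1 / a 0)"
      by (simp add: field_simps)
    moreover have "Y \<le> (g s + R) * s" using norm_F_upper[OF k R(1), of v] by (simp add: Fv s_def Y_def)
    ultimately have "Y \<le> g s * \<kappa> * (1 + 1 / a 0) * s"
      using mult_right_mono[of "g s + R" "g s * \<kappa> * (1 + 1 / a 0)" s] s by linarith
    then have "Y\<^sup>2 \<le> (g s * \<kappa> * (1 + 1 / a 0) * s)\<^sup>2" using s by (intro power_mono) auto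
    also have "\<dots> = g s * (\<kappa>\<^sup>2 * (1 + 1 / a 0)\<^sup>2 * (g s * s\<^sup>2))" by (simp add: power2_eq_square mult_ac)
    also have "\<dots> \<le> (A * B powr \<beta> * (1 + Y) powr \<beta>) * (\<kappa>\<^sup>2 * (1 + 1 / a 0)\<^sup>2 * (g s * s\<^sup>2))"
      using gB gs by (intro mult_right_mono) auto
    also have "\<dots> = D * (1 + Y) powr \<beta> * (\<kappa>\<^sup>2 * (g s * s\<^sup>2))" by (simp add: D_def mult_ac)
    finally have "Y\<^sup>2 \<le> D * (1 + Y) powr \<beta> * (\<kappa>\<^sup>2 * (g s * s\<^sup>2))" .
    moreover have "g s * s\<^sup>2 = X R k y \<bullet> y"
      using inner_F[of R k v] unfolding s_def Fv by (simp add: v_def inner_commute[of y])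
    ultimately show ?thesis
      using D s by (simp add: powr_minus field_simps flip: Y_def)
  qed
  moreover have "1 / D > 0" using D by simp
  ultimately show ?thesis by blast
qed

end

section \<open>Bounds for the constants and for the body force\<close>

lemma r_max_ge:
  assumes "bounded U" "x \<in> closure U"
  shows "norm x \<le> r_max U"
proof -
  have "bdd_above (norm ` closure U)"
    using bounded_closure[OF assms(1)] by (auto simp: bounded_iff intro: bdd_aboveI2)
  then show ?thesis unfolding r_max_def using assms(2) by (intro cSup_upper) auto
qed

lemma r_max_pos:
  assumes "open U" "bounded U" "U \<noteq> {}"
  shows "r_max U > 0"
proof (rule ccontr)
  assume "\<not> r_max U > 0"
  then have "norm x \<le> 0" if "x \<in> U" for x
    using r_max_ge[OF assms(2), of x] subsetD[OF closure_subset that] by linarith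
  then have "U \<subseteq> {0}" by auto
  then have "finite U" by (rule finite_subset) simp
  then show False using assms(1,3) finite_imp_not_open by blast
qed

text \<open>In the maximum defining \<open>d_star\<close>, the entry
  \<open>2 * \<rho> / \<phi>\<close> controls the rotation constant, which equals
  \<open>sqrt (G / r) * (2 * \<rho> / \<phi>) * w\<close> with \<open>w\<close> the scaled angular
  speed, and the entry \<open>sqrt r\<close> gives \<open>sqrt G \<le> d\<close>. The force bound is
  \<open>G * (1 + w^2)\<close>, which is at most \<open>d^2 * (1 + w)^2\<close>.\<close>

lemma chi_star_bounds:
  assumes "\<phi> > 0" "G > 0" "\<Omega> \<ge> 0" "\<rho> \<ge> 0" "r > 0"
  shows "chi_star \<phi> G \<Omega> \<rho> r \<ge> 1"
    and "Rconst \<phi> \<Omega> \<rho> \<le> chi_star \<phi> G \<Omega> \<rho> r"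
    and "G + \<Omega>\<^sup>2 * r \<le> (chi_star \<phi> G \<Omega> \<rho> r)\<^sup>2"
proof -
  define w where "w = Omega_star G \<Omega> r"
  define d where "d = d_star \<phi> G \<rho> r"
  have w: "w \<ge> 0" using assms by (simp add: w_def Omega_star_def)
  have d1: "sqrt (G / r) * (2 * \<rho> / \<phi>) \<le> d" unfolding d_def d_star_def
    using assms by (intro mult_left_mono Max_ge) auto
  have d2: "sqrt (G / r) * sqrt r \<le> d" unfolding d_def d_star_def
    using assms by (intro mult_left_mono Max_ge) auto
  then have d2: "sqrt G \<le> d" using assms by (simp add: real_sqrt_divide)
  have d0: "d \<ge> 0" using d2 assms by (meson order_trans real_sqrt_ge_zero less_imp_le)
  have chi: "d * (1 + w) \<le> chi_star \<phi> G \<Omega> \<rho> r" by (simp add: chi_star_def d_def w_def)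
  show "chi_star \<phi> G \<Omega> \<rho> r \<ge> 1" by (simp add: chi_star_def)
  have "Rconst \<phi> \<Omega> \<rho> = sqrt (G / r) * (2 * \<rho> / \<phi>) * w"
    using assms by (simp add: Rconst_def w_def Omega_star_def real_sqrt_divide field_simps)
  also have "\<dots> \<le> d * w" using d1 w by (rule mult_right_mono)
  also have "\<dots> \<le> d * (1 + w)" using d0 by (simp add: distrib_left)
  finally show "Rconst \<phi> \<Omega> \<rho> \<le> chi_star \<phi> G \<Omega> \<rho> r" using chi by simp
  have w2: "w\<^sup>2 = \<Omega>\<^sup>2 * (r / G)" using assms by (simp add: w_def Omega_star_def power_mult_distrib)
  have "G + \<Omega>\<^sup>2 * r = (sqrt G)\<^sup>2 * (1 + w\<^sup>2)" using assms by (simp add: w2 field_simps)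
  also have "\<dots> \<le> d\<^sup>2 * (1 + w)\<^sup>2"
    using d2 assms w by (intro mult_mono power_mono) (auto simp: power2_eq_square algebra_simps)
  also have "\<dots> = (d * (1 + w))\<^sup>2" by (simp add: power_mult_distrib)
  also have "\<dots> \<le> (chi_star \<phi> G \<Omega> \<rho> r)\<^sup>2" using chi d0 w by (intro power_mono) auto
  finally show "G + \<Omega>\<^sup>2 * r \<le> (chi_star \<phi> G \<Omega> \<rho> r)\<^sup>2" .
qed

lemma Zfield_eq: "Zfield G \<Omega> k e x t = - (G *\<^sub>R e t) + \<Omega>\<^sup>2 *\<^sub>R cross3 k (cross3 k x)"
  by (simp add: Zfield_def Jmat_mult flip: matrix_vector_mul_assoc)

lemma norm_Zfield_le:
  assumes "norm k = 1" "norm (e t) = 1" "G > 0"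
  shows "norm (Zfield G \<Omega> k e x t) \<le> G + \<Omega>\<^sup>2 * norm x"
proof -
  have "norm (cross3 k (cross3 k x)) \<le> norm x"
    using norm_cross3_le[of k "cross3 k x"] norm_cross3_le[of k x] assms by simp
  then have "norm (\<Omega>\<^sup>2 *\<^sub>R cross3 k (cross3 k x)) \<le> \<Omega>\<^sup>2 * norm x" by (simp add: mult_left_mono)
  moreover have "norm (- (G *\<^sub>R e t)) = G" using assms by simp
  ultimately show ?thesis unfolding Zfield_eq 
    by (smt (verit) norm_triangle_ineq)
qed

lemma bounded_linear_cross3_cross3: "bounded_linear (\<lambda>x. \<Omega>\<^sup>2 *\<^sub>R cross3 k (cross3 k x))"
  using linear_cross3[of k]
  by (intro bounded_linear_const_scaleR linear_conv_bounded_linear[THEN iffD1])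
     (auto intro: linear_compose[unfolded o_def])

lemma Zfield_has_derivative:
  "((\<lambda>x. Zfield G \<Omega> k e x t) has_derivative (\<lambda>x. \<Omega>\<^sup>2 *\<^sub>R cross3 k (cross3 k x))) (at x)"
  unfolding Zfield_eq
  using has_derivative_add[OF has_derivative_const[of "- (G *\<^sub>R e t)"]
      bounded_linear_imp_has_derivative[OF bounded_linear_cross3_cross3]]
  by simp

lemma Zfield_continuous:
  assumes "continuous_on UNIV e"
  shows "continuous_on S (\<lambda>(x, t). Zfield G \<Omega> k e x t)"
  unfolding Zfield_eq case_prod_unfold
  by (intro continuous_intros continuous_on_compose2[OF assms] continuous_on_cross) auto

section \<open>The energy estimate\<close>

lemma set_integral_mono_subset:
  fixes f :: "'a \<Rightarrow> real"
  assumes f: "set_integrable M B f" and A: "A \<in> sets M" "A \<subseteq> B" and nonneg: "\<And>x. x \<in> B \<Longrightarrow> 0 \<le> f x"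
  shows "(LINT x:A|M. f x) \<le> (LINT x:B|M. f x)"
  unfolding set_lebesgue_integral_def
proof (rule integral_mono)
  show "integrable M (\<lambda>x. indicator A x *\<^sub>R f x)" "integrable M (\<lambda>x. indicator B x *\<^sub>R f x)"
    using set_integrable_subset[OF f A] f by (auto simp: set_integrable_def)
  show "indicator A x *\<^sub>R f x \<le> indicator B x *\<^sub>R f x" for x
    using A(2) nonneg[of x] by (auto simp: indicator_def)
qed

text \<open>Young's inequality absorbs half of the coercive term; \<open>y\<close>, \<open>z\<close>, \<open>d\<close> and \<open>E'\<close> are the values of
  \<open>\<nabla>u + u\<^sup>2Z\<close>, \<open>Z\<close>, \<open>\<nabla>\<Psi>\<close> and \<open>\<Psi>\<^sub>t\<close>.\<close>

lemma energy_density_le: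
  fixes y v z d :: "'a::real_inner" and E E' u \<psi> :: real
  assumes v: "norm v \<le> c1 * (k * norm y)" "c2 * (k * (norm y)\<^sup>2) \<le> \<kappa>\<^sup>2 * (v \<bullet> y)"
    and z: "norm z \<le> \<kappa>\<^sup>2" and u: "\<bar>u\<bar> \<le> M"
    and pos: "0 \<le> k" "k \<le> 1" "0 < c1" "0 < c2" "1 \<le> \<kappa>" "0 < \<phi>" "\<phi> \<le> 1"
  shows "c2 / 2 * (k * (norm y)\<^sup>2) + \<kappa>\<^sup>2 * (\<phi> * (E - E') * (u - \<psi>))
    \<le> \<kappa>\<^sup>2 * (\<phi> * E * (u - \<psi>) + v \<bullet> (y - u\<^sup>2 *\<^sub>R z - d))
      + (c1\<^sup>2 / c2 + 1) * (\<kappa>^8 * (M\<^sup>2 * (M + 1)\<^sup>2) + \<kappa>^4 * ((norm d)\<^sup>2 + \<phi> * E'\<^sup>2 + \<phi> * \<psi>\<^sup>2))"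
proof -
  have M: "M \<ge> 0" using u by linarith
  have uM: "u\<^sup>2 \<le> M\<^sup>2" using u by (simp add: abs_le_square_iff[symmetric])
  \<comment> \<open>\<open>q\<close> bounds the part of the flux term that has to be absorbed; its
    first summand carries the factor \<open>\<kappa>^2\<close> of the body force and is the origin
    of the power 8.\<close>
  define q where "q = u\<^sup>2 * \<kappa>\<^sup>2 + norm d"
  have q: "q \<ge> 0" by (simp add: q_def)
  have "v \<bullet> (u\<^sup>2 *\<^sub>R z + d) \<le> norm v * norm (u\<^sup>2 *\<^sub>R z + d)" by (rule norm_cauchy_schwarz)
  also have "norm (u\<^sup>2 *\<^sub>R z + d) \<le> q"
    unfolding q_def using z by (intro norm_triangle_mono) (auto intro: mult_left_mono)
  then have "norm v * norm (u\<^sup>2 *\<^sub>R z + d) \<le> c1 * (k * norm y) * q"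
    using v(1) pos by (intro mult_mono) auto
  finally have 1: "\<kappa>\<^sup>2 * (v \<bullet> (u\<^sup>2 *\<^sub>R z + d)) \<le> \<kappa>\<^sup>2 * (c1 * (k * norm y) * q)"
    by (intro mult_left_mono) auto
  \<comment> \<open>Young's inequality as a completed square, weighted such that exactly
    \<open>c2 / 2\<close> of the coercive term is spent.\<close>
  have "0 \<le> (k / (2 * c2)) * (c2 * norm y - \<kappa>\<^sup>2 * c1 * q)\<^sup>2" using pos by simp
  also have "\<dots> = c2 / 2 * (k * (norm y)\<^sup>2) - \<kappa>\<^sup>2 * (c1 * (k * norm y) * q) + k * (c1\<^sup>2 / (2 * c2) * \<kappa>^4 * q\<^sup>2)"
    using pos by (simp add: field_simps power2_eq_square power4_eq_xxxx)
  finally have 2: "\<kappa>\<^sup>2 * (c1 * (k * norm y) * q) \<le> c2 / 2 * (k * (norm y)\<^sup>2) + k * (c1\<^sup>2 / (2 * c2) * \<kappa>^4 * q\<^sup>2)"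
    by simp
  have "k * (c1\<^sup>2 / (2 * c2) * \<kappa>^4 * q\<^sup>2) \<le> 1 * (c1\<^sup>2 / (2 * c2) * \<kappa>^4 * q\<^sup>2)"
    using pos by (intro mult_right_mono) auto
  also have "\<dots> \<le> c1\<^sup>2 / (2 * c2) * \<kappa>^4 * (2 * (u\<^sup>2 * \<kappa>\<^sup>2)\<^sup>2 + 2 * (norm d)\<^sup>2)"
  proof -
    have "q\<^sup>2 \<le> 2 * (u\<^sup>2 * \<kappa>\<^sup>2)\<^sup>2 + 2 * (norm d)\<^sup>2"
      unfolding q_def using zero_le_power2[of "u\<^sup>2 * \<kappa>\<^sup>2 - norm d"] by (simp add: power2_sum power2_diff)
    then show ?thesis unfolding mult_1_left using pos by (intro mult_left_mono) auto
  qed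
  also have "\<dots> = c1\<^sup>2 / c2 * (\<kappa>^8 * (u\<^sup>2)\<^sup>2 + \<kappa>^4 * (norm d)\<^sup>2)"
    using pos by (simp add: field_simps power_mult_distrib flip: power_mult power_add)
  finally have 3: "k * (c1\<^sup>2 / (2 * c2) * \<kappa>^4 * q\<^sup>2) \<le> c1\<^sup>2 / c2 * (\<kappa>^8 * (u\<^sup>2)\<^sup>2 + \<kappa>^4 * (norm d)\<^sup>2)" .
  have M1: "1 \<le> (M + 1)\<^sup>2" using M by simp
  have "M\<^sup>2 \<le> (M + 1)\<^sup>2" using M by simp
  then have M2: "M\<^sup>2 * M\<^sup>2 \<le> M\<^sup>2 * (M + 1)\<^sup>2" by (rule mult_left_mono) simp
  have M3: "M\<^sup>2 * 1 \<le> M\<^sup>2 * (M + 1)\<^sup>2" using M1 by (rule mult_left_mono) simp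
  have "(u\<^sup>2)\<^sup>2 \<le> M\<^sup>2 * M\<^sup>2" using power_mono[OF uM, of 2] by (simp add: power2_eq_square)
  with M2 have "(u\<^sup>2)\<^sup>2 \<le> M\<^sup>2 * (M + 1)\<^sup>2" by linarith
  then have 4: "c1\<^sup>2 / c2 * (\<kappa>^8 * (u\<^sup>2)\<^sup>2 + \<kappa>^4 * (norm d)\<^sup>2) \<le> c1\<^sup>2 / c2 * (\<kappa>^8 * (M\<^sup>2 * (M + 1)\<^sup>2) + \<kappa>^4 * (norm d)\<^sup>2)"
    using pos by (intro mult_left_mono add_right_mono) auto
  have 5: "- (\<phi> * E' * (u - \<psi>)) \<le> \<phi> * E'\<^sup>2 + M\<^sup>2 + \<phi> * \<psi>\<^sup>2"
  proof -
    \<comment> \<open>The three squares add up to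
      \<open>2 * (E'^2 + E' * (u - \<psi>) + u^2 + \<psi>^2)\<close>: the mixed terms in
      \<open>u\<close> and \<open>\<psi>\<close> cancel.\<close>
    have "0 \<le> (E' + (u - \<psi>))\<^sup>2 + E'\<^sup>2 + (u + \<psi>)\<^sup>2" by simp
    then have "- (E' * (u - \<psi>)) \<le> E'\<^sup>2 + u\<^sup>2 + \<psi>\<^sup>2" by (simp add: power2_eq_square algebra_simps)
    then have "\<phi> * - (E' * (u - \<psi>)) \<le> \<phi> * (E'\<^sup>2 + u\<^sup>2 + \<psi>\<^sup>2)" using pos by (intro mult_left_mono) auto
    moreover have "\<phi> * u\<^sup>2 \<le> 1 * M\<^sup>2" using pos uM by (intro mult_mono) auto
    ultimately show ?thesis by (simp add: algebra_simps)
  qed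
  have "\<kappa>\<^sup>2 \<le> \<kappa>^8" "\<kappa>\<^sup>2 \<le> \<kappa>^4" using pos by (auto intro: power_increasing)
  then have "\<kappa>\<^sup>2 * M\<^sup>2 \<le> \<kappa>^8 * (M\<^sup>2 * (M + 1)\<^sup>2)" "\<kappa>\<^sup>2 * (\<phi> * E'\<^sup>2 + \<phi> * \<psi>\<^sup>2) \<le> \<kappa>^4 * (\<phi> * E'\<^sup>2 + \<phi> * \<psi>\<^sup>2)"
    using M3 pos by (auto intro!: mult_mono mult_right_mono)
  moreover have "\<kappa>\<^sup>2 * - (\<phi> * E' * (u - \<psi>)) \<le> \<kappa>\<^sup>2 * (\<phi> * E'\<^sup>2 + M\<^sup>2 + \<phi> * \<psi>\<^sup>2)"
    using 5 by (rule mult_left_mono) simp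
  ultimately have 6: "- (\<kappa>\<^sup>2 * (\<phi> * E' * (u - \<psi>))) \<le> \<kappa>^8 * (M\<^sup>2 * (M + 1)\<^sup>2) + \<kappa>^4 * (\<phi> * E'\<^sup>2 + \<phi> * \<psi>\<^sup>2)"
    by (simp add: distrib_left)
  have 7: "0 \<le> c1\<^sup>2 / c2 * (\<kappa>^4 * (\<phi> * E'\<^sup>2 + \<phi> * \<psi>\<^sup>2))" "0 \<le> \<kappa>^4 * (norm d)\<^sup>2" using pos by auto
  have "v \<bullet> (y - u\<^sup>2 *\<^sub>R z - d) = v \<bullet> y - v \<bullet> (u\<^sup>2 *\<^sub>R z + d)"
    by (simp add: inner_diff_right inner_add_right)
  then have 8: "\<kappa>\<^sup>2 * (v \<bullet> (y - u\<^sup>2 *\<^sub>R z - d)) = \<kappa>\<^sup>2 * (v \<bullet> y) - \<kappa>\<^sup>2 * (v \<bullet> (u\<^sup>2 *\<^sub>R z + d))"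
    by (simp add: right_diff_distrib)
  have "c2 / 2 * (k * (norm y)\<^sup>2) = c2 * (k * (norm y)\<^sup>2) - c2 / 2 * (k * (norm y)\<^sup>2)" by simp
  then have 9: "c2 / 2 * (k * (norm y)\<^sup>2) \<le> \<kappa>\<^sup>2 * (v \<bullet> (y - u\<^sup>2 *\<^sub>R z - d))
      + c1\<^sup>2 / c2 * (\<kappa>^8 * (M\<^sup>2 * (M + 1)\<^sup>2) + \<kappa>^4 * (norm d)\<^sup>2)"
    using 1 2 3 4 8 v(2) by linarith
  have 10: "\<kappa>\<^sup>2 * (\<phi> * (E - E') * (u - \<psi>)) = \<kappa>\<^sup>2 * (\<phi> * E * (u - \<psi>)) - \<kappa>\<^sup>2 * (\<phi> * E' * (u - \<psi>))"
    by (simp add: algebra_simps)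
  have 11: "(c1\<^sup>2 / c2 + 1) * (\<kappa>^8 * (M\<^sup>2 * (M + 1)\<^sup>2) + \<kappa>^4 * ((norm d)\<^sup>2 + \<phi> * E'\<^sup>2 + \<phi> * \<psi>\<^sup>2))
    = c1\<^sup>2 / c2 * (\<kappa>^8 * (M\<^sup>2 * (M + 1)\<^sup>2) + \<kappa>^4 * (norm d)\<^sup>2) + c1\<^sup>2 / c2 * (\<kappa>^4 * (\<phi> * E'\<^sup>2 + \<phi> * \<psi>\<^sup>2))
     + (\<kappa>^8 * (M\<^sup>2 * (M + 1)\<^sup>2) + \<kappa>^4 * (\<phi> * E'\<^sup>2 + \<phi> * \<psi>\<^sup>2)) + \<kappa>^4 * (norm d)\<^sup>2"
    by (simp add: algebra_simps)
  show ?thesis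
    unfolding 11 using 6 7 9 10 by (simp only: distrib_left)
qed

text \<open>With \<open>p\<close> the argument of the flux, the difference is the gradient of
  \<open>u\<close>. As the weight \<open>k\<close> is at most 1, the return from \<open>p\<close> to
  the gradient costs only an additive constant.\<close>

lemma weighted_norm_le:
  fixes p z :: "'a::real_normed_vector"
  assumes "0 \<le> k" "k \<le> 1" "norm z \<le> \<kappa>\<^sup>2" "\<bar>u\<bar> \<le> M"
  shows "k * (norm (p - u\<^sup>2 *\<^sub>R z))\<^sup>2 \<le> 2 * (k * (norm p)\<^sup>2) + 2 * (\<kappa>^4 * M^4)"
proof -
  have uM: "u\<^sup>2 \<le> M\<^sup>2" using assms by (simp add: abs_le_square_iff[symmetric])
  have "norm (u\<^sup>2 *\<^sub>R z) \<le> M\<^sup>2 * \<kappa>\<^sup>2" using uM assms by (auto intro: mult_mono)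
  then have "norm (p - u\<^sup>2 *\<^sub>R z) \<le> norm p + M\<^sup>2 * \<kappa>\<^sup>2" using norm_triangle_ineq4[of p "u\<^sup>2 *\<^sub>R z"] by linarith
  then have "(norm (p - u\<^sup>2 *\<^sub>R z))\<^sup>2 \<le> (norm p + M\<^sup>2 * \<kappa>\<^sup>2)\<^sup>2" by (intro power_mono) auto
  also have "\<dots> \<le> 2 * (norm p)\<^sup>2 + 2 * (M\<^sup>2 * \<kappa>\<^sup>2)\<^sup>2"
    using zero_le_power2[of "norm p - M\<^sup>2 * \<kappa>\<^sup>2"] by (simp add: power2_sum power2_diff)
  finally have "k * (norm (p - u\<^sup>2 *\<^sub>R z))\<^sup>2 \<le> k * (2 * (norm p)\<^sup>2 + 2 * (M\<^sup>2 * \<kappa>\<^sup>2)\<^sup>2)"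
    using assms(1) by (rule mult_left_mono)
  moreover have "k * (2 * (M\<^sup>2 * \<kappa>\<^sup>2)\<^sup>2) \<le> 1 * (2 * (M\<^sup>2 * \<kappa>\<^sup>2)\<^sup>2)"
    using assms by (intro mult_right_mono) auto
  moreover have "(M\<^sup>2 * \<kappa>\<^sup>2)\<^sup>2 = \<kappa>^4 * M^4" by (simp add: power_mult_distrib flip: power_mult)
  ultimately show ?thesis by (simp add: distrib_left)
qed

text \<open>The triangle inequality is used with the maximum of the two lengths because its power
  splits without a further constant. The factor 4 bounds \<open>2 powr (2 - b)\<close>. Comparing
  \<open>1 + s\<close> with \<open>2 * s\<close> for \<open>s > 1\<close> doubles it to 8, and 12
  counts three terms of size at most \<open>\<kappa>^4 * (M + 1)^4\<close>: two ones and the square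
  of \<open>r\<close>.\<close>

lemma powr_norm_le:
  fixes p z :: "'a::real_normed_vector"
  assumes b: "0 < b" "b < 1" and "1 \<le> \<kappa>" and "norm z \<le> \<kappa>\<^sup>2" "\<bar>u\<bar> \<le> M"
  shows "norm (p - u\<^sup>2 *\<^sub>R z) powr (2 - b) \<le> 8 * ((1 + norm p) powr - b * (norm p)\<^sup>2) + 12 * (\<kappa>^4 * (M + 1)^4)"
proof -
  define s where "s = norm p"
  define r where "r = M\<^sup>2 * \<kappa>\<^sup>2"
  have M: "M \<ge> 0" using assms by linarith
  have sr: "s \<ge> 0" "r \<ge> 0" by (auto simp: s_def r_def)
  have uM: "u\<^sup>2 \<le> M\<^sup>2" using assms by (simp add: abs_le_square_iff[symmetric])
  have "norm (u\<^sup>2 *\<^sub>R z) \<le> r" unfolding r_def using uM assms by (auto intro: mult_mono)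
  then have "norm (p - u\<^sup>2 *\<^sub>R z) \<le> 2 * max s r" using norm_triangle_ineq4[of p "u\<^sup>2 *\<^sub>R z"] by (simp add: s_def)
  then have "norm (p - u\<^sup>2 *\<^sub>R z) powr (2 - b) \<le> (2 * max s r) powr (2 - b)" using b by (intro powr_mono2) auto
  also have "\<dots> = 2 powr (2 - b) * max s r powr (2 - b)" using sr by (simp add: powr_mult)
  also have "\<dots> \<le> 4 * (s powr (2 - b) + r powr (2 - b))"
  proof (rule mult_mono)
    have "(2::real) powr (2 - b) \<le> 2 powr 2" using b by (intro powr_mono) auto
    then show "(2::real) powr (2 - b) \<le> 4" by simp
    show "max s r powr (2 - b) \<le> s powr (2 - b) + r powr (2 - b)" by (simp add: max_def)
  qed auto
  finally have 1: "norm (p - u\<^sup>2 *\<^sub>R z) powr (2 - b) \<le> 4 * (s powr (2 - b) + r powr (2 - b))" .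
  have 2: "s powr (2 - b) \<le> 1 + 2 * ((1 + s) powr - b * s\<^sup>2)"
  proof (cases "s \<le> 1")
    case True
    then have "s powr (2 - b) \<le> 1 powr (2 - b)" using sr b by (intro powr_mono2) auto
    then show ?thesis by (simp add: add_increasing2)
  next
    case False
    have "(1 + s) powr b \<le> (2 * s) powr b" using False b by (intro powr_mono2) auto
    also have "\<dots> = 2 powr b * s powr b" using sr by (simp add: powr_mult)
    also have "\<dots> \<le> 2 powr 1 * s powr b" using b by (intro mult_right_mono powr_mono) auto
    finally have "s powr (- b) \<le> 2 * (1 + s) powr - b"
      using False by (simp add: powr_minus field_simps)
    then have "s powr (- b) * s\<^sup>2 \<le> 2 * (1 + s) powr - b * s\<^sup>2" by (rule mult_right_mono) simp
    moreover have "s powr (2 - b) = s powr (- b) * s\<^sup>2"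
      using False by (simp add: powr_diff powr_minus field_simps)
    ultimately show ?thesis by simp
  qed
  have 3: "r powr (2 - b) \<le> 1 + r\<^sup>2"
  proof (cases "r \<le> 1")
    case True
    then have "r powr (2 - b) \<le> 1 powr (2 - b)" using sr b by (intro powr_mono2) auto
    then show ?thesis by (simp add: add_increasing2)
  next
    case False
    then have "r powr (2 - b) \<le> r powr 2" using b by (intro powr_mono) auto
    then show ?thesis using False by simp
  qed
  define Y where "Y = \<kappa>^4 * (M + 1)^4"
  have k1: "1 \<le> \<kappa>^4" using assms by simp
  have "1 \<le> (M + 1)^4" using M by simp
  then have "1 * 1 \<le> Y" unfolding Y_def using k1 by (intro mult_mono) auto
  moreover have "M^4 \<le> (M + 1)^4" using M by (intro power_mono) auto
  then have "\<kappa>^4 * M^4 \<le> Y" unfolding Y_def using k1 by (intro mult_left_mono) auto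
  moreover have "r\<^sup>2 = \<kappa>^4 * M^4" by (simp add: r_def power_mult_distrib flip: power_mult)
  moreover have "4 * (S + R) \<le> 8 * A + 12 * Y" if "S \<le> 1 + 2 * A" "R \<le> 1 + B" "B \<le> Y" "1 \<le> Y" for S R A B :: real
    unfolding distrib_left using that by simp
  ultimately have "4 * (s powr (2 - b) + r powr (2 - b)) \<le> 8 * ((1 + s) powr - b * s\<^sup>2) + 12 * Y"
    using 2 3 by simp
  with 1 show ?thesis by (simp add: s_def Y_def)
qed

text \<open>\<open>\<kappa>\<close> stands for \<open>\<chi>\<^sub>*\<close>, \<open>l\<close> for \<open>a\<^sub>0\<close> and \<open>b\<close> for the paper's \<open>a\<close>; \<open>D\<close>, \<open>H\<close>, \<open>E\<close> are continuous extensions of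
  the derivatives of \<open>u\<close> to the closure, and similarly for \<open>\<Psi>\<close>.\<close>

locale flow =
  fixes U :: "(real^3) set" and T \<phi> l c1 c2 b \<kappa> M :: real
    and X :: "real^3 \<Rightarrow> real^3" and Z :: "real^3 \<Rightarrow> real \<Rightarrow> real^3" and Z' :: "real^3 \<Rightarrow> real^3"
    and u :: "real^3 \<Rightarrow> real \<Rightarrow> real" and D :: "real^3 \<Rightarrow> real \<Rightarrow> real^3"
    and H :: "real^3 \<Rightarrow> real \<Rightarrow> real^3^3" and E :: "real^3 \<Rightarrow> real \<Rightarrow> real"
    and \<Psi> :: "real^3 \<Rightarrow> real \<Rightarrow> real" and D\<Psi> :: "real^3 \<Rightarrow> real \<Rightarrow> real^3" and E\<Psi> :: "real^3 \<Rightarrow> real \<Rightarrow> real"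
  assumes U: "open U" "bounded U" "negligible (frontier U)"
    and pos: "0 < T" "0 < \<phi>" "\<phi> \<le> 1" "0 < l" "0 < c1" "0 < c2" "0 < b" "b < 1" "1 \<le> \<kappa>" "0 \<le> M"
    and X_cont: "continuous_on UNIV X"
    and X_der: "\<And>y. \<exists>X'. (X has_derivative X') (at y) \<and> (\<forall>h. norm (X' h) \<le> norm h / l)"
    and X_up: "\<And>y. norm (X y) \<le> c1 * ((1 + norm y) powr - b * norm y)"
    and X_low: "\<And>y. c2 * ((1 + norm y) powr - b * (norm y)\<^sup>2) \<le> \<kappa>\<^sup>2 * (X y \<bullet> y)"
    and Z_cont: "continuous_on UNIV (\<lambda>(x, t). Z x t)"
    and Z_der: "\<And>x t. ((\<lambda>x. Z x t) has_derivative Z') (at x)"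
    and Z_le: "\<And>x t. x \<in> closure U \<Longrightarrow> norm (Z x t) \<le> \<kappa>\<^sup>2"
    and u_cont: "continuous_on (closure U \<times> {0..T}) (\<lambda>(x, t). u x t)"
    and D_cont: "continuous_on (closure U \<times> {0<..T}) (\<lambda>(x, t). D x t)"
    and H_cont: "continuous_on (closure U \<times> {0<..T}) (\<lambda>(x, t). H x t)"
    and E_cont: "continuous_on (closure U \<times> {0<..T}) (\<lambda>(x, t). E x t)"
    and u_D: "\<And>x t. x \<in> U \<Longrightarrow> t \<in> {0<..T} \<Longrightarrow> GDERIV (\<lambda>y. u y t) x :> D x t"
    and D_H: "\<And>x t. x \<in> U \<Longrightarrow> t \<in> {0<..T} \<Longrightarrow> ((\<lambda>y. D y t) has_derivative (\<lambda>h. H x t *v h)) (at x)"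
    and u_E: "\<And>x t. x \<in> U \<Longrightarrow> t \<in> {0<..T} \<Longrightarrow> (u x has_real_derivative E x t) (at t within {0..T})"
    and \<Psi>_cont: "continuous_on (closure U \<times> {0..T}) (\<lambda>(x, t). \<Psi> x t)"
    and D\<Psi>_cont: "continuous_on (closure U \<times> {0..T}) (\<lambda>(x, t). D\<Psi> x t)"
    and E\<Psi>_cont: "continuous_on (closure U \<times> {0..T}) (\<lambda>(x, t). E\<Psi> x t)"
    and \<Psi>_D: "\<And>x t. x \<in> U \<Longrightarrow> t \<in> {0..T} \<Longrightarrow> GDERIV (\<lambda>y. \<Psi> y t) x :> D\<Psi> x t"
    and \<Psi>_E: "\<And>x t. x \<in> U \<Longrightarrow> t \<in> {0..T} \<Longrightarrow> (\<Psi> x has_real_derivative E\<Psi> x t) (at t within {0..T})"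
    and boundary: "\<And>x t. x \<in> frontier U \<Longrightarrow> t \<in> {0<..T} \<Longrightarrow> u x t = \<Psi> x t"
    and pde: "\<And>x t. x \<in> U \<Longrightarrow> t \<in> {0<..T} \<Longrightarrow>
       \<phi> * E x t = divergence (\<lambda>y. X (D y t + (u y t)\<^sup>2 *\<^sub>R Z y t)) x"
    and u_le: "\<And>x t. x \<in> U \<Longrightarrow> t \<in> {0..T} \<Longrightarrow> \<bar>u x t\<bar> \<le> M"
begin

section \<open>Weak form of the equation on a time slice\<close>

definition w where "w x t = u x t - \<Psi> x t"
definition P where "P x t = D x t + (u x t)\<^sup>2 *\<^sub>R Z x t"
definition K where "K x t = (1 + norm (P x t)) powr - b"

lemmas conts = u_cont[unfolded case_prod_unfold] D_cont[unfolded case_prod_unfold]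
  H_cont[unfolded case_prod_unfold] E_cont[unfolded case_prod_unfold]
  \<Psi>_cont[unfolded case_prod_unfold] D\<Psi>_cont[unfolded case_prod_unfold] E\<Psi>_cont[unfolded case_prod_unfold]
  continuous_on_subset[OF Z_cont[unfolded case_prod_unfold] subset_UNIV]

lemma closureU: "x \<in> U \<Longrightarrow> x \<in> closure U"
  using closure_subset by auto

lemma strip_subset: "0 < s \<Longrightarrow> closure U \<times> {s..T} \<subseteq> closure U \<times> {0<..T}"
  "closure U \<times> {0<..T} \<subseteq> closure U \<times> {0..T}"
  by auto

lemma conts_open:
  "continuous_on (closure U \<times> {0<..T}) (\<lambda>z. u (fst z) (snd z))"
  "continuous_on (closure U \<times> {0<..T}) (\<lambda>z. \<Psi> (fst z) (snd z))"
  "continuous_on (closure U \<times> {0<..T}) (\<lambda>z. D\<Psi> (fst z) (snd z))"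
  "continuous_on (closure U \<times> {0<..T}) (\<lambda>z. E\<Psi> (fst z) (snd z))"
  by (rule continuous_on_subset[OF _ strip_subset(2)], rule conts)+

lemma w_cont: "continuous_on (closure U \<times> {0..T}) (\<lambda>z. w (fst z) (snd z))"
  unfolding w_def by (intro continuous_intros conts)

lemma w_cont_open: "continuous_on (closure U \<times> {0<..T}) (\<lambda>z. w (fst z) (snd z))"
  by (rule continuous_on_subset[OF w_cont strip_subset(2)])

lemma P_cont: "continuous_on (closure U \<times> {0<..T}) (\<lambda>z. P (fst z) (snd z))"
  unfolding P_def by (intro continuous_intros conts conts_open)

lemma K_cont: "continuous_on (closure U \<times> {0<..T}) (\<lambda>z. K (fst z) (snd z))"
  unfolding K_def
  by (intro continuous_intros P_cont) (auto simp: add_nonneg_eq_0_iff)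

lemma slice:
  assumes "continuous_on (closure U \<times> I) (\<lambda>z. f (fst z) (snd z))" "t \<in> I"
  shows "continuous_on (closure U) (\<lambda>x. f x t)"
proof -
  have "continuous_on (closure U) (\<lambda>x. (x, t))" by (intro continuous_intros)
  from continuous_on_compose2[OF assms(1) this] assms(2) show ?thesis by auto
qed

lemma slice_bound:
  fixes f :: "real^3 \<Rightarrow> real \<Rightarrow> 'b::real_normed_vector"
  assumes "continuous_on (closure U \<times> I) (\<lambda>z. f (fst z) (snd z))" "t \<in> I"
  obtains B where "\<And>x. x \<in> closure U \<Longrightarrow> norm (f x t) \<le> B"
proof -
  have "compact (closure U)" using U(2) by simp
  from compact_imp_bounded[OF compact_continuous_image[OF slice[OF assms] this]]
  obtain B where "\<forall>x\<in>closure U. norm (f x t) \<le> B" by (auto simp: bounded_iff)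
  then show ?thesis using that by blast
qed

lemma norm_matrix_axis_le:
  fixes A :: "real^3^3"
  shows "norm (A *v axis i 1) \<le> 3 * norm A"
proof -
  have "\<bar>(A *v axis i 1) $ j\<bar> \<le> norm A" for j
  proof -
    have "\<bar>A $ j $ i\<bar> \<le> norm (A $ j)" by (rule component_le_norm_cart)
    also have "\<dots> \<le> norm A" by (rule Finite_Cartesian_Product.norm_nth_le)
    finally show ?thesis by (simp add: matrix_vector_mult_basis column_def)
  qed
  then have "(\<Sum>j\<in>UNIV. \<bar>(A *v axis i 1) $ j\<bar>) \<le> (\<Sum>j\<in>(UNIV::3 set). norm A)" by (rule sum_mono)
  then show ?thesis using norm_le_l1_cart[of "A *v axis i 1"] by simp
qed

text \<open>This is the equation tested with \<open>w\<close>: by the chain rule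
  \<open>X (P x t)\<close> is differentiable in \<open>U\<close>, with divergence
  \<open>\<phi> * E x t\<close>. At fixed \<open>t > 0\<close> continuity up to the closure bounds
  the derivatives of \<open>u\<close>; the resulting bounds \<open>L1\<close> and \<open>L\<close>
  depend on \<open>t\<close> and on the solution, but they only justify the integration by parts and
  never reach the final constant.\<close>

lemma flux_identity:
  assumes t: "t \<in> {0<..T}"
  shows "(LINT x:U|lborel. \<phi> * E x t * w x t + X (P x t) \<bullet> (D x t - D\<Psi> x t)) = 0"
proof -
  obtain X' where X': "\<And>y. (X has_derivative X' y) (at y)" "\<And>y h. norm (X' y h) \<le> norm h / l"
    using choice[OF allI, of "\<lambda>y X'. (X has_derivative X') (at y) \<and> (\<forall>h. norm (X' h) \<le> norm h / l)", OF X_der] by blast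
  define P' where "P' x h = H x t *v h + ((2 * u x t * (h \<bullet> D x t)) *\<^sub>R Z x t + (u x t)\<^sup>2 *\<^sub>R Z' h)" for x h
  have P_der: "((\<lambda>x. P x t) has_derivative P' x) (at x)" if x: "x \<in> U" for x
  proof -
    have u1: "((\<lambda>y. u y t) has_derivative (\<lambda>h. h \<bullet> D x t)) (at x)"
      using u_D[OF x t] by (simp add: gderiv_def)
    have "((\<lambda>y. (u y t)\<^sup>2) has_derivative (\<lambda>h. 2 * u x t * (h \<bullet> D x t))) (at x)"
      using has_derivative_power[OF u1, of 2] by (simp add: mult_ac)
    from has_derivative_add[OF D_H[OF x t] has_derivative_scaleR[OF this Z_der[of t x]]]
    show ?thesis unfolding P_def P'_def by (simp add: add.commute)
  qed
  obtain BH where BH: "\<And>x. x \<in> closure U \<Longrightarrow> norm (H x t) \<le> BH"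
    using slice_bound[OF conts(3) t] by blast
  obtain BD where BD: "\<And>x. x \<in> closure U \<Longrightarrow> norm (D x t) \<le> BD"
    using slice_bound[OF conts(2) t] by blast
  obtain B\<Psi> where B\<Psi>: "\<And>x. x \<in> closure U \<Longrightarrow> norm (D\<Psi> x t) \<le> B\<Psi>"
    using slice_bound[OF conts_open(3) t] by blast
  obtain BZ where BZ: "\<And>h. norm (Z' h) \<le> norm h * BZ"
    using bounded_linear.bounded[OF has_derivative_bounded_linear[OF Z_der]] by blast
  define L1 where "L1 = (3 * BH + (2 * M * BD * \<kappa>\<^sup>2 + M\<^sup>2 * BZ)) / l"
  have L1: "\<bar>X' (P x t) (P' x (axis i 1)) $ i\<bar> \<le> L1" if x: "x \<in> U" for x i
  proof -
    note xc = closureU[OF x]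
    have uM: "\<bar>u x t\<bar> \<le> M" using u_le[OF x, of t] t by auto
    have "norm (H x t *v axis i 1) \<le> 3 * BH" using norm_matrix_axis_le[of "H x t" i] BH[OF xc] by linarith
    moreover have "norm ((2 * u x t * (axis i 1 \<bullet> D x t)) *\<^sub>R Z x t) \<le> 2 * M * BD * \<kappa>\<^sup>2"
    proof -
      have "\<bar>axis i 1 \<bullet> D x t\<bar> \<le> BD"
        using component_le_norm_cart[of "D x t" i] BD[OF xc] by (simp add: inner_axis')
      then have *: "\<bar>2 * u x t\<bar> * \<bar>axis i 1 \<bullet> D x t\<bar> \<le> 2 * M * BD"
        using uM by (intro mult_mono) auto
      then have "\<bar>2 * u x t * (axis i 1 \<bullet> D x t)\<bar> * norm (Z x t) \<le> 2 * M * BD * \<kappa>\<^sup>2"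
        using Z_le[OF xc, of t] * order_trans[OF mult_nonneg_nonneg[OF abs_ge_zero abs_ge_zero] *]
        by (intro mult_mono) (simp_all add: abs_mult)
      then show ?thesis by simp
    qed
    moreover have "norm ((u x t)\<^sup>2 *\<^sub>R Z' (axis i 1)) \<le> M\<^sup>2 * BZ"
    proof -
      have "(u x t)\<^sup>2 \<le> M\<^sup>2" using uM by (simp add: abs_le_square_iff[symmetric])
      then have "(u x t)\<^sup>2 * norm (Z' (axis i 1)) \<le> M\<^sup>2 * BZ"
        using BZ[of "axis i 1"] by (intro mult_mono) (auto simp: norm_axis_1)
      then show ?thesis by simp
    qed
    ultimately have "norm (P' x (axis i 1)) \<le> 3 * BH + (2 * M * BD * \<kappa>\<^sup>2 + M\<^sup>2 * BZ)"
      unfolding P'_def by (intro norm_triangle_mono)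
    then have "norm (P' x (axis i 1)) / l \<le> L1"
      unfolding L1_def using pos(4) by (intro divide_right_mono) auto
    then show ?thesis
      using X'(2)[of "P x t" "P' x (axis i 1)"] component_le_norm_cart[of "X' (P x t) (P' x (axis i 1))" i] by linarith
  qed
  define L where "L = max L1 (BD + B\<Psi>)"
  have V_der: "((\<lambda>x. X (P x t)) has_derivative (\<lambda>h. X' (P x t) (P' x h))) (at x)" if "x \<in> U" for x
    by (rule has_derivative_compose[OF P_der[OF that] X'(1)])
  have "(LINT x:U|lborel. (\<Sum>i\<in>UNIV. X' (P x t) (P' x (axis i 1)) $ i) * w x t + X (P x t) \<bullet> (D x t - D\<Psi> x t)) = 0"
  proof (rule integral_divergence_eq_0[OF U _ V_der, where L = L])
    show "continuous_on (closure U) (\<lambda>x. X (P x t))"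
      by (rule continuous_on_compose2[OF X_cont slice[OF P_cont t]]) auto
    show "continuous_on (closure U) (\<lambda>x. w x t)" by (rule slice[OF w_cont_open t])
    show "GDERIV (\<lambda>x. w x t) x :> D x t - D\<Psi> x t" if "x \<in> U" for x
      unfolding w_def using GDERIV_diff[OF u_D[OF that t] \<Psi>_D[OF that]] t by auto
    show "w x t = 0" if "x \<in> frontier U" for x
      unfolding w_def using boundary[OF that t] by simp
    show "\<bar>X' (P x t) (P' x (axis i 1)) $ i\<bar> \<le> L" if "x \<in> U" for x i
      using L1[OF that, of i] by (simp add: L_def)
    show "norm (D x t - D\<Psi> x t) \<le> L" if "x \<in> U" for x
      using norm_triangle_ineq4[of "D x t" "D\<Psi> x t"] BD[OF closureU[OF that]] B\<Psi>[OF closureU[OF that]]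
      by (simp add: L_def)
  qed
  moreover have "(\<Sum>i\<in>UNIV. X' (P x t) (P' x (axis i 1)) $ i) = \<phi> * E x t" if "x \<in> U" for x
    using pde[OF that t] divergence_eq[OF V_der[OF that]] by (simp add: P_def)
  ultimately show ?thesis
    by (subst set_lebesgue_integral_cong[where g = "\<lambda>x. (\<Sum>i\<in>UNIV. X' (P x t) (P' x (axis i 1)) $ i) * w x t + X (P x t) \<bullet> (D x t - D\<Psi> x t)"])
       (use U(1) in auto)
qed

section \<open>Energy inequality on strips and passage to the initial time\<close>

definition vol where "vol = measure lborel U"
definition flux_density where "flux_density z = K (fst z) (snd z) * (norm (P (fst z) (snd z)))\<^sup>2"
definition data_density where "data_density z = (norm (D\<Psi> (fst z) (snd z)))\<^sup>2 + \<phi> * (E\<Psi> (fst z) (snd z))\<^sup>2 + \<phi> * (\<Psi> (fst z) (snd z))\<^sup>2"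
definition W where "W t = (LINT x:U|lborel. (w x t)\<^sup>2)"

lemma strip_cont:
  "continuous_on (closure U \<times> {0<..T}) h \<Longrightarrow> 0 < s \<Longrightarrow> continuous_on (closure U \<times> {s..T}) h"
  by (rule continuous_on_subset[OF _ strip_subset(1)])

lemmas strip_integrable = set_integrable_cylinder[OF U(1,2) strip_cont]

lemma flux_density_cont: "continuous_on (closure U \<times> {0<..T}) flux_density"
  unfolding flux_density_def by (intro continuous_intros P_cont K_cont)

lemma data_density_cont: "continuous_on (closure U \<times> {0..T}) data_density"
  unfolding data_density_def by (intro continuous_intros conts)

lemma K_bounds: "0 \<le> K x t" "K x t \<le> 1"
  unfolding K_def using powr_mono2'[of "- b" 1 "1 + norm (P x t)"] pos by auto

lemma flux_density_nonneg: "0 \<le> flux_density z"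
  using K_bounds by (simp add: flux_density_def)

lemma data_density_nonneg: "0 \<le> data_density z"
  using pos by (simp add: data_density_def)

lemma cylinder_const:
  assumes "s \<le> T"
  shows "(LINT z:U \<times> {s..T}|lborel. c) = c * vol * (T - s)"
proof -
  have fin: "emeasure lborel U < \<infinity>" by (rule emeasure_bounded_finite[OF U(2)])
  have "(LINT x:U|lborel. c) = c * vol"
    using fin U(1) by (simp add: set_lebesgue_integral_def vol_def mult.commute)
  then show ?thesis
    using assms by (simp add: set_integral_cylinder(1)[OF U(1,2) continuous_on_const])
      (simp add: set_lebesgue_integral_def)
qed

lemma data_density_strip_le:
  assumes "0 \<le> s"
  shows "(LINT z:U \<times> {s..T}|lborel. data_density z) \<le> (LINT z:U \<times> {0..T}|lborel. data_density z)"
proof (rule set_integral_mono_subset)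
  show "set_integrable lborel (U \<times> {0..T}) data_density"
    by (rule set_integrable_cylinder[OF U(1,2) data_density_cont])
  show "U \<times> {s..T} \<in> sets lborel" using U(1) by (simp add: borel_prod[symmetric])
qed (use assms data_density_nonneg in auto)

text \<open>For fixed \<open>x\<close> the integrand is the time derivative of
  \<open>\<phi> / 2 * w^2\<close>, so the integral is a difference of energies; the one at time
  \<open>T\<close> is nonnegative and is dropped.\<close>

lemma time_integral_ge:
  assumes s: "0 < s" "s \<le> T"
  shows "- (\<phi> / 2 * W s) \<le> (LINT z:U \<times> {s..T}|lborel. \<phi> * (E (fst z) (snd z) - E\<Psi> (fst z) (snd z)) * w (fst z) (snd z))"
    (is "_ \<le> (LINT z:_|_. ?f z)")
proof -
  have cont: "continuous_on (closure U \<times> {s..T}) ?f"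
    by (rule strip_cont[OF _ s(1)]) (intro continuous_intros conts conts_open w_cont_open)
  have w2: "set_integrable lborel U (\<lambda>x. (w x t)\<^sup>2)" if "t \<in> {0..T}" for t
  proof (rule set_integrable_subset)
    show "set_integrable lborel (closure U) (\<lambda>x. (w x t)\<^sup>2)"
      unfolding set_integrable_def using U(2)
      by (intro borel_integrable_compact continuous_intros slice[OF w_cont that]) auto
  qed (use U(1) closure_subset in auto)
  have "(LINT z:U \<times> {s..T}|lborel. ?f z) = (LINT x:U|lborel. LINT t:{s..T}|lborel. ?f (x, t))"
    by (rule set_integral_cylinder(2)[OF U(1,2) cont])
  also have "\<dots> = (LINT x:U|lborel. \<phi> / 2 * (w x T)\<^sup>2 - \<phi> / 2 * (w x s)\<^sup>2)"
  proof (rule set_lebesgue_integral_cong)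
    show "U \<in> sets lborel" using U(1) by simp
    show "\<forall>x. x \<in> U \<longrightarrow> (LINT t:{s..T}|lborel. ?f (x, t)) = \<phi> / 2 * (w x T)\<^sup>2 - \<phi> / 2 * (w x s)\<^sup>2"
    proof (intro allI impI)
      fix x assume x: "x \<in> U"
      have "(LINT t|lborel. indicator {s..T} t *\<^sub>R ?f (x, t)) = \<phi> / 2 * (w x T)\<^sup>2 - \<phi> / 2 * (w x s)\<^sup>2"
      proof (rule integral_FTC_atLeastAtMost[OF s(2)])
        have "continuous_on {s..T} (\<lambda>t. (x, t))" by (intro continuous_intros)
        then show "continuous_on {s..T} (\<lambda>t. ?f (x, t))"
          by (rule continuous_on_compose2[OF cont]) (use closureU[OF x] in auto)
        fix t assume t: "s \<le> t" "t \<le> T"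
        have "(w x has_real_derivative E x t - E\<Psi> x t) (at t within {0..T})"
          unfolding w_def using t s x by (intro DERIV_diff u_E \<Psi>_E) auto
        then have d: "(w x has_real_derivative E x t - E\<Psi> x t) (at t within {s..T})"
          by (rule has_field_derivative_subset) (use s in auto)
        have "((\<lambda>t. \<phi> / 2 * (w x t)\<^sup>2) has_real_derivative \<phi> * (E x t - E\<Psi> x t) * w x t) (at t within {s..T})"
          by (rule derivative_eq_intros d refl)+ simp
        then show "((\<lambda>t. \<phi> / 2 * (w x t)\<^sup>2) has_vector_derivative ?f (x, t)) (at t within {s..T})"
          by (simp add: has_real_derivative_iff_has_vector_derivative)
      qed
      then show "(LINT t:{s..T}|lborel. ?f (x, t)) = \<phi> / 2 * (w x T)\<^sup>2 - \<phi> / 2 * (w x s)\<^sup>2"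
        by (simp add: set_lebesgue_integral_def)
    qed
  qed
  also have "\<dots> = \<phi> / 2 * W T - \<phi> / 2 * W s"
    using w2[of T] w2[of s] s by (simp add: W_def)
  finally have eq: "(LINT z:U \<times> {s..T}|lborel. ?f z) = \<phi> / 2 * W T - \<phi> / 2 * W s" .
  have "0 \<le> \<phi> / 2 * W T"
    unfolding W_def set_lebesgue_integral_def using pos by (intro mult_nonneg_nonneg integral_nonneg_AE) auto
  then show ?thesis unfolding eq by simp
qed

lemma flux_integral_eq_0:
  assumes s: "0 < s" "s \<le> T"
  shows "(LINT z:U \<times> {s..T}|lborel. \<phi> * E (fst z) (snd z) * w (fst z) (snd z)
      + X (P (fst z) (snd z)) \<bullet> (D (fst z) (snd z) - D\<Psi> (fst z) (snd z))) = 0"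
    (is "(LINT z:_|_. ?f z) = 0")
proof -
  have cont: "continuous_on (closure U \<times> {s..T}) ?f"
    by (rule strip_cont[OF _ s(1)])
       (intro continuous_intros conts conts_open w_cont_open continuous_on_compose2[OF X_cont P_cont], auto)
  have "(LINT z:U \<times> {s..T}|lborel. ?f z) = (LINT t:{s..T}|lborel. LINT x:U|lborel. ?f (x, t))"
    by (rule set_integral_cylinder(1)[OF U(1,2) cont])
  also have "\<dots> = (LINT t:{s..T}|lborel. 0)"
    using flux_identity s by (intro set_lebesgue_integral_cong) auto
  finally show ?thesis by (simp add: set_lebesgue_integral_def)
qed

definition c3 where "c3 = c1\<^sup>2 / c2 + 1"

text \<open>The pointwise inequality integrated over the strip. Its flux term has integral zero and
  its time term costs the energy at time \<open>s\<close>; the data terms are enlarged to the whole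
  cylinder, so that on the right only \<open>W s\<close> still depends on \<open>s\<close>.\<close>

lemma energy_step:
  assumes s: "0 < s" "s \<le> T"
  shows "c2 / 2 * (LINT z:U \<times> {s..T}|lborel. flux_density z) \<le> \<kappa>\<^sup>2 * (\<phi> / 2 * W s) +
    c3 * (\<kappa>^8 * (M\<^sup>2 * (M + 1)\<^sup>2) * (T * vol) + \<kappa>^4 * (LINT z:U \<times> {0..T}|lborel. data_density z))"
proof -
  define S where "S = U \<times> {s..T}"
  define time_term where "time_term z = \<phi> * (E (fst z) (snd z) - E\<Psi> (fst z) (snd z)) * w (fst z) (snd z)" for z
  define flux_term where "flux_term z = \<phi> * E (fst z) (snd z) * w (fst z) (snd z)
      + X (P (fst z) (snd z)) \<bullet> (D (fst z) (snd z) - D\<Psi> (fst z) (snd z))" for z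
  define C where "C = c3 * (\<kappa>^8 * (M\<^sup>2 * (M + 1)\<^sup>2))"
  have c3: "c3 > 0" using pos by (simp add: c3_def add_nonneg_pos)
  have C: "C \<ge> 0" using pos c3 by (simp add: C_def)
  have i1: "set_integrable lborel S flux_density" unfolding S_def by (rule strip_integrable[OF flux_density_cont s(1)])
  have i2: "set_integrable lborel S time_term" unfolding S_def time_term_def
    by (rule strip_integrable[OF _ s(1)]) (intro continuous_intros conts conts_open w_cont_open)
  have i3: "set_integrable lborel S flux_term" unfolding S_def flux_term_def
    by (rule strip_integrable[OF _ s(1)])
       (intro continuous_intros conts conts_open w_cont_open continuous_on_compose2[OF X_cont P_cont], auto)
  have i4: "set_integrable lborel S data_density" unfolding S_def
    by (rule strip_integrable[OF continuous_on_subset[OF data_density_cont strip_subset(2)] s(1)])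
  have ic: "set_integrable lborel S (\<lambda>z. C)" unfolding S_def
    by (rule strip_integrable[OF _ s(1)]) (intro continuous_intros)
  have "(LINT z:S|lborel. c2 / 2 * flux_density z + \<kappa>\<^sup>2 * time_term z) \<le> (LINT z:S|lborel. \<kappa>\<^sup>2 * flux_term z + (C + c3 * \<kappa>^4 * data_density z))"
  proof (rule set_integral_mono)
    show "set_integrable lborel S (\<lambda>z. c2 / 2 * flux_density z + \<kappa>\<^sup>2 * time_term z)"
      using i1 i2 by (intro set_integral_add set_integrable_mult_right) auto
    show "set_integrable lborel S (\<lambda>z. \<kappa>\<^sup>2 * flux_term z + (C + c3 * \<kappa>^4 * data_density z))"
      using i3 i4 ic by (intro set_integral_add set_integrable_mult_right) auto
    fix z assume "z \<in> S"
    then obtain x t where z: "z = (x, t)" "x \<in> U" "t \<in> {s..T}" by (auto simp: S_def)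
    have "X (P x t) \<bullet> (D x t - D\<Psi> x t) = X (P x t) \<bullet> (P x t - (u x t)\<^sup>2 *\<^sub>R Z x t - D\<Psi> x t)"
      by (simp add: P_def)
    then show "c2 / 2 * flux_density z + \<kappa>\<^sup>2 * time_term z \<le> \<kappa>\<^sup>2 * flux_term z + (C + c3 * \<kappa>^4 * data_density z)"
      using energy_density_le[of "X (P x t)" c1 "K x t" "P x t" c2 \<kappa> "Z x t" "u x t" M \<phi> "E x t" "E\<Psi> x t" "\<Psi> x t" "D\<Psi> x t"]
        X_up[of "P x t"] X_low[of "P x t"] Z_le[OF closureU[OF z(2)], of t] u_le[OF z(2), of t] z(3) s K_bounds[of x t] pos
      unfolding z(1) flux_density_def time_term_def flux_term_def data_density_def C_def w_def K_def fst_conv snd_conv c3_def[symmetric]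
      by (simp add: distrib_left mult.assoc)
  qed
  moreover have "(LINT z:S|lborel. c2 / 2 * flux_density z + \<kappa>\<^sup>2 * time_term z) = c2 / 2 * (LINT z:S|lborel. flux_density z) + \<kappa>\<^sup>2 * (LINT z:S|lborel. time_term z)"
    using i1 i2 by (subst set_integral_add) (auto intro: set_integrable_mult_right)
  moreover have "(LINT z:S|lborel. \<kappa>\<^sup>2 * flux_term z + (C + c3 * \<kappa>^4 * data_density z)) =
      \<kappa>\<^sup>2 * (LINT z:S|lborel. flux_term z) + ((LINT z:S|lborel. C) + c3 * \<kappa>^4 * (LINT z:S|lborel. data_density z))"
    using i3 i4 ic by (subst set_integral_add, (intro set_integral_add set_integrable_mult_right; simp),
      (intro set_integral_add set_integrable_mult_right; simp))
      (subst set_integral_add, auto intro: set_integrable_mult_right)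
  moreover have "(LINT z:S|lborel. flux_term z) = 0"
    unfolding S_def flux_term_def by (rule flux_integral_eq_0[OF s])
  moreover have "\<kappa>\<^sup>2 * - (\<phi> / 2 * W s) \<le> \<kappa>\<^sup>2 * (LINT z:S|lborel. time_term z)"
    unfolding S_def time_term_def by (rule mult_left_mono[OF time_integral_ge[OF s]]) simp
  moreover have "(LINT z:S|lborel. C) \<le> C * (T * vol)"
  proof -
    have "vol \<ge> 0" by (simp add: vol_def)
    then have "C * vol * (T - s) \<le> C * vol * T" using C s by (intro mult_left_mono) auto
    then show ?thesis using cylinder_const[OF s(2), of C] by (simp add: S_def mult_ac)
  qed
  moreover have "c3 * \<kappa>^4 * (LINT z:S|lborel. data_density z) \<le> c3 * \<kappa>^4 * (LINT z:U \<times> {0..T}|lborel. data_density z)"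
    unfolding S_def using c3 s by (intro mult_left_mono data_density_strip_le) auto
  ultimately show ?thesis
    unfolding S_def C_def by (simp add: distrib_left mult.assoc)
qed

text \<open>\<open>w\<close> is continuous up to \<open>t = 0\<close>, hence bounded on the closed
  cylinder, and dominated convergence applies.\<close>

lemma W_tendsto:
  assumes c: "\<And>n. c n \<in> {0..T}" "c \<longlonglongrightarrow> (0::real)"
  shows "(\<lambda>n. W (c n)) \<longlonglongrightarrow> W 0"
proof -
  have 0: "0 \<in> {0..T}" using pos by simp
  have "compact (closure U \<times> {0..T})" using U(2) by (intro compact_Times) auto
  from compact_imp_bounded[OF compact_continuous_image[OF w_cont this]]
  obtain B where B: "\<And>z. z \<in> closure U \<times> {0..T} \<Longrightarrow> \<bar>w (fst z) (snd z)\<bar> \<le> B"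
    unfolding bounded_iff by (metis (no_types, lifting) image_eqI real_norm_def)
  have meas: "(\<lambda>x. indicator U x *\<^sub>R (w x t)\<^sup>2) \<in> borel_measurable lborel" if "t \<in> {0..T}" for t
    using borel_measurable_continuous_on_indicator[of U "\<lambda>x. (w x t)\<^sup>2"] U(1)
      continuous_on_subset[OF slice[OF w_cont that] closure_subset]
    by (simp add: continuous_on_power)
  show ?thesis
    unfolding W_def set_lebesgue_integral_def
  proof (rule integral_dominated_convergence[where w = "\<lambda>x. B\<^sup>2 * indicator U x"])
    show "integrable lborel (\<lambda>x. B\<^sup>2 * indicator U x)"
      using U(1) emeasure_bounded_finite[OF U(2)] by (intro integrable_mult_right integrable_real_indicator) auto
    show "AE x in lborel. (\<lambda>n. indicator U x *\<^sub>R (w x (c n))\<^sup>2) \<longlonglongrightarrow> indicator U x *\<^sub>R (w x 0)\<^sup>2"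
    proof (rule AE_I2)
      fix x
      show "(\<lambda>n. indicator U x *\<^sub>R (w x (c n))\<^sup>2) \<longlonglongrightarrow> indicator U x *\<^sub>R (w x 0)\<^sup>2"
      proof (cases "x \<in> U")
        case True
        have "(\<lambda>n. (x, c n)) \<longlonglongrightarrow> (x, 0)" by (intro tendsto_intros c(2))
        then have "(\<lambda>n. w x (c n)) \<longlonglongrightarrow> w x 0"
          using continuous_on_tendsto_compose[OF w_cont, of "\<lambda>n. (x, c n)" "(x, 0)"] c(1) 0 closureU[OF True] by simp
        then show ?thesis by (auto intro!: tendsto_intros)
      qed simp
    qed
    show "AE x in lborel. norm (indicator U x *\<^sub>R (w x (c n))\<^sup>2) \<le> B\<^sup>2 * indicator U x" for n
    proof (rule AE_I2)
      fix x
      show "norm (indicator U x *\<^sub>R (w x (c n))\<^sup>2) \<le> B\<^sup>2 * indicator U x"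
        using B[of "(x, c n)"] c(1)[of n] closureU[of x]
        by (cases "x \<in> U") (simp_all add: abs_le_square_iff[symmetric])
    qed
  qed (use meas c(1) 0 in auto)
qed

text \<open>The strip inequality is applied to longer strips starting at \<open>c n \<le> s\<close>:
  the left side can only grow since the density is nonnegative, while \<open>W (c n)\<close> tends
  to \<open>W 0\<close>.\<close>

lemma energy_estimate:
  assumes s: "0 < s" "s \<le> T"
  shows "c2 / 2 * (LINT z:U \<times> {s..T}|lborel. flux_density z) \<le> \<kappa>\<^sup>2 * (\<phi> / 2 * W 0) +
    c3 * (\<kappa>^8 * (M\<^sup>2 * (M + 1)\<^sup>2) * (T * vol) + \<kappa>^4 * (LINT z:U \<times> {0..T}|lborel. data_density z))"
    (is "?I \<le> _ + ?R")
proof -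
  define c where "c n = s / real (Suc n)" for n
  have c: "0 < c n" "c n \<le> s" for n using s by (auto simp: c_def field_simps)
  have c0: "c \<longlonglongrightarrow> 0" unfolding c_def using LIMSEQ_Suc[OF lim_const_over_n[of s]] .
  have "(\<lambda>n. \<kappa>\<^sup>2 * (\<phi> / 2 * W (c n)) + ?R) \<longlonglongrightarrow> \<kappa>\<^sup>2 * (\<phi> / 2 * W 0) + ?R"
    by (intro tendsto_intros W_tendsto c0) (use c s in \<open>auto intro: less_imp_le order_trans\<close>)
  moreover have "?I \<le> \<kappa>\<^sup>2 * (\<phi> / 2 * W (c n)) + ?R" for n
  proof -
    have cn: "c n \<le> T" using c[of n] s by simp
    have "(LINT z:U \<times> {s..T}|lborel. flux_density z) \<le> (LINT z:U \<times> {c n..T}|lborel. flux_density z)"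
    proof (rule set_integral_mono_subset)
      show "set_integrable lborel (U \<times> {c n..T}) flux_density" by (rule strip_integrable[OF flux_density_cont c(1)])
      show "U \<times> {s..T} \<in> sets lborel" using U(1) by (simp add: borel_prod[symmetric])
      show "U \<times> {s..T} \<subseteq> U \<times> {c n..T}" using c[of n] by auto
    qed (use flux_density_nonneg in auto)
    then have "?I \<le> c2 / 2 * (LINT z:U \<times> {c n..T}|lborel. flux_density z)" using pos by simp
    then show ?thesis using energy_step[OF c(1) cn] by linarith
  qed
  ultimately show ?thesis using LIMSEQ_le_const by blast
qed

text \<open>The factor \<open>2 / c2\<close> removes the coefficient of the coercive term,
  \<open>1 / 2\<close> belongs to the initial energy, and \<open>c3 * (1 + vol)\<close> covers the
  two remaining terms at once. None of \<open>\<kappa>\<close>, \<open>M\<close> and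
  \<open>T\<close> enters.\<close>

definition C0 where "C0 = 2 / c2 * (1 / 2 + c3 * (1 + vol))"

definition A where "A = \<kappa>\<^sup>2 * (\<phi> * W 0) + \<kappa>^8 * (M\<^sup>2 * (M + 1)\<^sup>2) * T
  + \<kappa>^4 * (LINT z:U \<times> {0..T}|lborel. data_density z)"

section \<open>Bounds for the gradient integrals by the data\<close>

lemma c3_pos: "c3 > 0"
  using pos by (simp add: c3_def add_nonneg_pos)

lemma vol_nonneg: "vol \<ge> 0"
  by (simp add: vol_def)

lemma W_nonneg: "0 \<le> W t"
  unfolding W_def set_lebesgue_integral_def by (intro integral_nonneg_AE) auto

lemma data_density_integral_nonneg: "0 \<le> (LINT z:U \<times> {0..T}|lborel. data_density z)"
  unfolding set_lebesgue_integral_def using data_density_nonneg by (intro integral_nonneg_AE) auto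

lemma flux_density_integral_le:
  assumes s: "0 < s" "s \<le> T"
  shows "(LINT z:U \<times> {s..T}|lborel. flux_density z) \<le> C0 * A"
proof -
  define a1 where "a1 = \<kappa>\<^sup>2 * (\<phi> * W 0)"
  define a2 where "a2 = \<kappa>^8 * (M\<^sup>2 * (M + 1)\<^sup>2) * T"
  define a3 where "a3 = \<kappa>^4 * (LINT z:U \<times> {0..T}|lborel. data_density z)"
  have nn: "a1 \<ge> 0" "a2 \<ge> 0" "a3 \<ge> 0"
    using pos W_nonneg data_density_integral_nonneg by (auto simp: a1_def a2_def a3_def)
  have "c2 / 2 * (LINT z:U \<times> {s..T}|lborel. flux_density z) \<le> a1 / 2 + c3 * (a2 * vol + a3)"
    using energy_estimate[OF s] by (simp add: a1_def a2_def a3_def mult_ac)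
  also have "\<dots> \<le> (a1 + a2 + a3) / 2 + c3 * ((1 + vol) * (a1 + a2 + a3))"
    using nn vol_nonneg c3_pos by (intro add_mono mult_left_mono) (auto simp: algebra_simps)
  also have "\<dots> = (1 / 2 + c3 * (1 + vol)) * (a1 + a2 + a3)"
    by (simp add: distrib_right mult.assoc)
  finally have "c2 / 2 * (LINT z:U \<times> {s..T}|lborel. flux_density z) \<le> (1 / 2 + c3 * (1 + vol)) * A"
    by (simp add: A_def a1_def a2_def a3_def)
  then show ?thesis using pos by (simp add: C0_def field_simps)
qed

text \<open>Both gradient integrands are dominated by the flux density plus a constant. The
  resulting bound is the same for all \<open>s > 0\<close>, as the exhaustion of the cylinder by
  strips requires.\<close>

lemma integral_le_of_density:
  assumes cont: "continuous_on (closure U \<times> {0<..T}) h"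
    and nonneg: "\<And>x t. 0 \<le> h (x, t)"
    and le: "\<And>x t. x \<in> U \<Longrightarrow> t \<in> {0<..T} \<Longrightarrow> h (x, t) \<le> p * flux_density (x, t) + c"
    and "0 \<le> p" "0 \<le> c"
  shows "(\<integral>\<^sup>+ t \<in> {0<..T}. (\<integral>\<^sup>+ x \<in> U. ennreal (h (x, t)) \<partial>lborel) \<partial>lborel) \<le> ennreal (p * (C0 * A) + c * (T * vol))"
proof (rule nn_integral_cylinder_le[OF U(1,2) cont nonneg _ pos(1)])
  fix s assume s: "0 < s" "s \<le> T"
  have i: "set_integrable lborel (U \<times> {s..T}) flux_density" "set_integrable lborel (U \<times> {s..T}) (\<lambda>z. c)"
    by (rule strip_integrable[OF flux_density_cont s(1)]) (rule strip_integrable[OF continuous_on_const s(1)])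
  have "(LINT z:U \<times> {s..T}|lborel. h z) \<le> (LINT z:U \<times> {s..T}|lborel. p * flux_density z + c)"
  proof (rule set_integral_mono)
    show "set_integrable lborel (U \<times> {s..T}) h" by (rule strip_integrable[OF cont s(1)])
    show "set_integrable lborel (U \<times> {s..T}) (\<lambda>z. p * flux_density z + c)"
      using i by (intro set_integral_add set_integrable_mult_right) auto
    show "h z \<le> p * flux_density z + c" if "z \<in> U \<times> {s..T}" for z
      using le[of "fst z" "snd z"] that s by (cases z) auto
  qed
  also have "\<dots> = p * (LINT z:U \<times> {s..T}|lborel. flux_density z) + c * vol * (T - s)"
    using i by (subst set_integral_add) (auto simp: cylinder_const[OF s(2)] intro: set_integrable_mult_right)
  also have "\<dots> \<le> p * (C0 * A) + c * (T * vol)"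
  proof (rule add_mono)
    show "p * (LINT z:U \<times> {s..T}|lborel. flux_density z) \<le> p * (C0 * A)"
      using flux_density_integral_le[OF s] assms(4) by (rule mult_left_mono)
    have "c * vol * (T - s) \<le> c * vol * T" using s assms(5) vol_nonneg by (intro mult_left_mono) auto
    then show "c * vol * (T - s) \<le> c * (T * vol)" by (simp add: mult_ac)
  qed
  finally show "(LINT z:U \<times> {s..T}|lborel. h z) \<le> p * (C0 * A) + c * (T * vol)" .
qed

lemma D_eq: "D x t = P x t - (u x t)\<^sup>2 *\<^sub>R Z x t"
  by (simp add: P_def)

lemma cylinder_nn_cong:
  assumes "\<And>x t. x \<in> U \<Longrightarrow> t \<in> {0<..T} \<Longrightarrow> f x t = g x t"
  shows "(\<integral>\<^sup>+ t \<in> {0<..T}. (\<integral>\<^sup>+ x \<in> U. f x t \<partial>lborel) \<partial>lborel)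
    = (\<integral>\<^sup>+ t \<in> {0<..T}. (\<integral>\<^sup>+ x \<in> U. g x t \<partial>lborel) \<partial>lborel)"
proof (rule nn_integral_cong)
  fix t
  show "(\<integral>\<^sup>+ x \<in> U. f x t \<partial>lborel) * indicator {0<..T} t = (\<integral>\<^sup>+ x \<in> U. g x t \<partial>lborel) * indicator {0<..T} t"
  proof (cases "t \<in> {0<..T}")
    case True
    have "(\<integral>\<^sup>+ x \<in> U. f x t \<partial>lborel) = (\<integral>\<^sup>+ x \<in> U. g x t \<partial>lborel)"
      by (rule nn_integral_cong) (use assms True in \<open>auto simp: indicator_def\<close>)
    then show ?thesis by simp
  qed simp
qed

lemma weighted_grad_integral_le:
  "weighted_grad_integral U T b Z u \<le> ennreal (2 * (C0 * A) + 2 * (\<kappa>^4 * M^4) * (T * vol))"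
proof -
  let ?h = "\<lambda>z. K (fst z) (snd z) * (norm (D (fst z) (snd z)))\<^sup>2"
  have "weighted_grad_integral U T b Z u = (\<integral>\<^sup>+ t \<in> {0<..T}. (\<integral>\<^sup>+ x \<in> U. ennreal (?h (x, t)) \<partial>lborel) \<partial>lborel)"
    unfolding weighted_grad_integral_def
    by (rule cylinder_nn_cong) (simp add: weight_def flux_arg_def grad_eq[OF u_D] K_def P_def)
  also have "\<dots> \<le> ennreal (2 * (C0 * A) + 2 * (\<kappa>^4 * M^4) * (T * vol))"
  proof (rule integral_le_of_density)
    show "continuous_on (closure U \<times> {0<..T}) ?h" by (intro continuous_intros K_cont conts)
    show "?h (x, t) \<le> 2 * flux_density (x, t) + 2 * (\<kappa>^4 * M^4)" if "x \<in> U" "t \<in> {0<..T}" for x t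
      using weighted_norm_le[OF K_bounds Z_le[OF closureU[OF that(1)]] u_le[OF that(1)]] that(2)
      by (simp add: flux_density_def D_eq)
  qed (use pos K_bounds in auto)
  finally show ?thesis .
qed

lemma power_grad_integral_le:
  "power_grad_integral U T (2 - b) u \<le> ennreal (8 * (C0 * A) + 12 * (\<kappa>^4 * (M + 1)^4) * (T * vol))"
proof -
  let ?h = "\<lambda>z. norm (D (fst z) (snd z)) powr (2 - b)"
  have "power_grad_integral U T (2 - b) u = (\<integral>\<^sup>+ t \<in> {0<..T}. (\<integral>\<^sup>+ x \<in> U. ennreal (?h (x, t)) \<partial>lborel) \<partial>lborel)"
    unfolding power_grad_integral_def
    by (rule cylinder_nn_cong) (simp add: grad_eq[OF u_D])
  also have "\<dots> \<le> ennreal (8 * (C0 * A) + 12 * (\<kappa>^4 * (M + 1)^4) * (T * vol))"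
  proof (rule integral_le_of_density)
    show "continuous_on (closure U \<times> {0<..T}) ?h"
      using pos by (intro continuous_on_powr' continuous_intros conts) auto
    show "?h (x, t) \<le> 8 * flux_density (x, t) + 12 * (\<kappa>^4 * (M + 1)^4)" if "x \<in> U" "t \<in> {0<..T}" for x t
      using powr_norm_le[OF pos(7,8,9) Z_le[OF closureU[OF that(1)]] u_le[OF that(1)]] that(2)
      by (simp add: flux_density_def D_eq K_def)
  qed (use pos in auto)
  finally show ?thesis .
qed

lemma E_star_eq: "E_star U T \<phi> \<Psi> = (LINT z:U \<times> {0..T}|lborel. data_density z)"
  unfolding E_star_def set_integral_cylinder(1)[OF U(1,2) data_density_cont]
proof (intro set_lebesgue_integral_cong allI impI)
  fix x t assume "x \<in> U" "t \<in> {0..T}"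
  then show "(norm (grad (\<lambda>y. \<Psi> y t) x))\<^sup>2 + \<phi> * (time_deriv T \<Psi> x t)\<^sup>2 + \<phi> * (\<Psi> x t)\<^sup>2 = data_density (x, t)"
    using grad_eq[OF \<Psi>_D] time_deriv_eq[OF \<Psi>_E _ pos(1)] by (simp add: data_density_def)
qed (use U(1) in auto)

lemma W_0_eq:
  assumes "\<And>x. x \<in> U \<Longrightarrow> u x 0 = u0 x"
  shows "W 0 = (L2_norm_on U (\<lambda>x. u0 x - \<Psi> x 0))\<^sup>2"
proof -
  have "W 0 = (LINT x:U|lborel. (u0 x - \<Psi> x 0)\<^sup>2)"
    unfolding W_def w_def using assms U(1) by (intro set_lebesgue_integral_cong) auto
  then show ?thesis using W_nonneg[of 0] by (simp add: L2_norm_on_def)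
qed

end

text \<open>The derivative inside the divergence is selected from the maps that qualify as
  derivatives, and these depend only on the function near \<open>x\<close>; so the equality holds
  even where no derivative exists. It serves to replace the gradient in the equation by its witness
  \<open>D\<close>, which is known to agree with it only in \<open>U\<close>.\<close>

lemma divergence_cong_open:
  assumes "open U" "x \<in> U" "\<And>y. y \<in> U \<Longrightarrow> f y = g y"
  shows "divergence f x = divergence g x"
proof -
  have "(f has_derivative f') (at x) \<longleftrightarrow> (g has_derivative f') (at x)" for f'
    using has_derivative_transform_within_open[OF _ assms(1,2), of f f' UNIV g]
      has_derivative_transform_within_open[OF _ assms(1,2), of g f' UNIV f] assms(3) by auto
  then show ?thesis by (simp add: divergence_def jacobian_def frechet_derivative_def)
qed

text \<open>As \<open>\<kappa> \<ge> 1\<close>, the integer powers 8 and 4 lie below the exponents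
  \<open>2 * (4 + b)\<close> and \<open>2 * (2 + b)\<close>. \<open>C\<close> is built from the
  larger coefficients of the two gradient bounds, 8 for the energy part and 12 for the additive
  constant, so that one constant serves all estimates.\<close>

lemma final_bounds:
  fixes \<kappa> b M T a E C0 vol :: real
  assumes k: "1 \<le> \<kappa>" and b: "0 < b" and nn: "0 \<le> M" "0 \<le> T" "0 \<le> a" "0 \<le> E" "0 < C0" "0 \<le> vol"
  defines "p \<equiv> \<kappa> powr (2 * (4 + b))" and "q \<equiv> \<kappa> powr (2 * (2 + b))" and "C \<equiv> 8 * C0 + 12 * vol"
    and "B \<equiv> C0 * (\<kappa>\<^sup>2 * a + \<kappa>^8 * (M\<^sup>2 * (M + 1)\<^sup>2) * T + \<kappa>^4 * E)"
  shows "2 * B + 2 * (\<kappa>^4 * M^4) * (T * vol) \<le> C * (\<kappa>\<^sup>2 * a + p * T * M\<^sup>2 * (M + 1)\<^sup>2 + q * E)"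
    and "8 * B + 12 * (\<kappa>^4 * (M + 1)^4) * (T * vol) \<le> C * (\<kappa>\<^sup>2 * a + p * T * (M + 1)^4 + q * E)"
    and "C * (\<kappa>\<^sup>2 * a + p * T * M\<^sup>2 * (M + 1)\<^sup>2 + q * E) \<le> C * p * (M + 1)\<^sup>2 * (a + T * M\<^sup>2 + E)"
    and "C * (\<kappa>\<^sup>2 * a + p * T * (M + 1)^4 + q * E) \<le> C * p * (M + 1)^4 * (a + T + E)"
    and "C * p * (M + 1)\<^sup>2 * (a + T * M\<^sup>2 + E) \<le> C * p * (M + 1)^4 * (a + T + E)"
proof -
  have C: "C > 0" using nn by (simp add: C_def add_pos_nonneg)
  have pow: "\<kappa>^n \<le> \<kappa> powr r" if "real n \<le> r" for n r
  proof -
    have "\<kappa>^n = \<kappa> powr real n" using k by (simp add: powr_realpow)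
    also have "\<dots> \<le> \<kappa> powr r" using k that by (intro powr_mono) auto
    finally show ?thesis .
  qed
  have p8: "\<kappa>^8 \<le> p" and p4: "\<kappa>^4 \<le> p" and p2: "\<kappa>\<^sup>2 \<le> p" and q4: "\<kappa>^4 \<le> q"
    using b unfolding p_def q_def by (auto intro!: pow)
  have qp: "q \<le> p" using k b unfolding p_def q_def by (intro powr_mono) auto
  have p0: "p \<ge> 0" "q \<ge> 0" by (auto simp: p_def q_def)
  define m where "m = (M + 1)\<^sup>2"
  have m1: "1 \<le> m" using nn by (simp add: m_def)
  have Mm: "M\<^sup>2 \<le> m" using nn by (simp add: m_def)
  have m4: "(M + 1)^4 = m * m" by (simp add: m_def power2_eq_square power4_eq_xxxx)
  have mm: "1 \<le> m * m" "m \<le> m * m" using m1 mult_mono[of 1 m 1 m] mult_left_mono[of 1 m m] by auto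
  have Mmm: "M\<^sup>2 * m \<le> m * m" using Mm m1 by (intro mult_right_mono) auto
  have M4: "M^4 \<le> M\<^sup>2 * m"
    using mult_left_mono[OF Mm, of "M\<^sup>2"] by (simp add: power2_eq_square power4_eq_xxxx)
  have t1: "\<kappa>^8 * (M\<^sup>2 * m) * T \<le> p * T * M\<^sup>2 * m"
    using mult_right_mono[OF p8, of "M\<^sup>2 * m * T"] nn m1 by (simp add: mult_ac)
  have t2: "\<kappa>^4 * M^4 * T \<le> p * T * M\<^sup>2 * m"
    using mult_mono[OF p4 M4] mult_right_mono[of "\<kappa>^4 * M^4" "p * (M\<^sup>2 * m)" T] nn p0 by (simp add: mult_ac)
  have t3: "p * T * M\<^sup>2 * m \<le> p * T * (m * m)"
    using mult_left_mono[OF Mmm, of "p * T"] nn p0 by (simp add: mult_ac)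
  have t4: "\<kappa>^4 * (m * m) * T \<le> p * T * (m * m)"
    using mult_right_mono[OF p4, of "m * m * T"] nn m1 by (simp add: mult_ac)
  have t5: "\<kappa>^4 * E \<le> q * E" using q4 nn by (intro mult_right_mono) auto
  \<comment> \<open>The volume term is no larger than the middle summand \<open>y\<close>, so it is
    paid by the \<open>12 * vol\<close> part of \<open>C\<close>, the energy part by
    \<open>8 * C0\<close>.\<close>
  have sumbd: "c * (C0 * (x1 + y1 + z1)) + d * (w * vol) \<le> C * (x + y + z)"
    if "x1 \<le> x" "y1 \<le> y" "z1 \<le> z" "w \<le> y" "0 \<le> c" "c \<le> 8" "0 \<le> d" "d \<le> 12" "0 \<le> x" "0 \<le> y" "0 \<le> z"
    for x1 y1 z1 x y z w c d
  proof -
    have "c * (C0 * (x1 + y1 + z1)) \<le> c * (C0 * (x + y + z))" using that nn by (intro mult_left_mono) auto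
    also have "\<dots> \<le> 8 * (C0 * (x + y + z))" using that nn by (intro mult_right_mono) auto
    finally have "c * (C0 * (x1 + y1 + z1)) \<le> 8 * (C0 * (x + y + z))" .
    moreover have "d * (w * vol) \<le> d * ((x + y + z) * vol)" using that nn by (intro mult_left_mono mult_right_mono) auto
    moreover have "d * ((x + y + z) * vol) \<le> 12 * ((x + y + z) * vol)" using that nn by (intro mult_right_mono) auto
    ultimately show ?thesis by (simp add: C_def algebra_simps)
  qed
  show "2 * B + 2 * (\<kappa>^4 * M^4) * (T * vol) \<le> C * (\<kappa>\<^sup>2 * a + p * T * M\<^sup>2 * (M + 1)\<^sup>2 + q * E)"
    using sumbd[OF order_refl t1 t5 t2, of 2 2 "\<kappa>\<^sup>2 * a"] nn p0 m1 by (simp add: B_def m_def mult_ac)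
  show "8 * B + 12 * (\<kappa>^4 * (M + 1)^4) * (T * vol) \<le> C * (\<kappa>\<^sup>2 * a + p * T * (M + 1)^4 + q * E)"
    using sumbd[OF order_refl order_trans[OF t1 t3] t5 t4, of 8 12 "\<kappa>\<^sup>2 * a"] nn p0 m1
    unfolding m4 by (simp add: B_def m_def mult_ac)
  have "\<kappa>\<^sup>2 * a \<le> p * m * a" using mult_mono[OF p2 m1] p0 nn mult_right_mono[of "\<kappa>\<^sup>2" "p * m" a] by simp
  moreover have "q * E \<le> p * m * E" using mult_mono[OF qp m1] p0 nn mult_right_mono[of q "p * m" E] by simp
  ultimately have 1: "\<kappa>\<^sup>2 * a + p * T * M\<^sup>2 * m + q * E \<le> p * m * (a + T * M\<^sup>2 + E)"
    by (simp add: algebra_simps)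
  then show "C * (\<kappa>\<^sup>2 * a + p * T * M\<^sup>2 * (M + 1)\<^sup>2 + q * E) \<le> C * p * (M + 1)\<^sup>2 * (a + T * M\<^sup>2 + E)"
    using C mult_left_mono[OF 1, of C] by (simp add: m_def mult_ac)
  have "\<kappa>\<^sup>2 * a \<le> p * (m * m) * a" using mult_mono[OF p2 mm(1)] p0 nn mult_right_mono[of "\<kappa>\<^sup>2" "p * (m * m)" a] by simp
  moreover have "q * E \<le> p * (m * m) * E" using mult_mono[OF qp mm(1)] p0 nn mult_right_mono[of q "p * (m * m)" E] by simp
  ultimately have 2: "\<kappa>\<^sup>2 * a + p * T * (m * m) + q * E \<le> p * (m * m) * (a + T + E)"
    by (simp add: algebra_simps)
  then show "C * (\<kappa>\<^sup>2 * a + p * T * (M + 1)^4 + q * E) \<le> C * p * (M + 1)^4 * (a + T + E)"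
    unfolding m4 using C mult_left_mono[OF 2, of C] by (simp add: mult_ac)
  have "m * a \<le> m * m * a" "m * E \<le> m * m * E" using mm nn by (auto intro: mult_right_mono)
  moreover have "m * (T * M\<^sup>2) \<le> m * m * T" using mult_right_mono[OF Mmm, of T] nn by (simp add: mult_ac)
  ultimately have 3: "m * (a + T * M\<^sup>2 + E) \<le> m * m * (a + T + E)" by (simp add: distrib_left)
  show "C * p * (M + 1)\<^sup>2 * (a + T * M\<^sup>2 + E) \<le> C * p * (M + 1)^4 * (a + T + E)"
    unfolding m4 using C p0 mult_left_mono[OF 3, of "C * p"] by (simp add: m_def mult_ac)
qed

section \<open>The gradient estimates\<close>

theorem theorem5p4:
  fixes N :: nat and a \<alpha> :: "nat \<Rightarrow> real" and U :: "(real^3) set"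
  assumes "N \<ge> 1"
    and "\<alpha> 0 = 0" and "\<forall>i<N. \<alpha> i < \<alpha> (Suc i)" and "\<forall>i\<le>N. a i > 0"
    and "open U" and "bounded U" and "U \<noteq> {}" and "C1_boundary U"
  shows "\<exists>C>0. \<forall>(k :: real^3) (\<phi> :: real) (G :: real) (\<Omega> :: real) (\<rho> :: real) (T :: real)
      (e0 :: real \<Rightarrow> real^3) (u :: real^3 \<Rightarrow> real \<Rightarrow> real) (u0 :: real^3 \<Rightarrow> real)
      (\<psi> :: real^3 \<Rightarrow> real \<Rightarrow> real) (\<Psi> :: real^3 \<Rightarrow> real \<Rightarrow> real).
    norm k = 1 \<longrightarrow> 0 < \<phi> \<longrightarrow> \<phi> \<le> 1 \<longrightarrow> 0 < G \<longrightarrow> 0 \<le> \<Omega> \<longrightarrow> 0 \<le> \<rho> \<longrightarrow> 0 < T \<longrightarrow>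
    smooth_curve e0 \<longrightarrow> (\<forall>t. norm (e0 t) = 1) \<longrightarrow>
    C21 U T u \<longrightarrow> continuous_on (closure U \<times> {0..T}) (\<lambda>(x, t). u x t) \<longrightarrow>
    solves_ibvp U T \<phi> (Xmap N a \<alpha> (Rconst \<phi> \<Omega> \<rho>) k) (Zfield G \<Omega> k e0) u0 \<psi> u \<longrightarrow>
    C1_cyl U T \<Psi> \<longrightarrow> (\<forall>x\<in>frontier U. \<forall>t\<in>{0<..T}. \<Psi> x t = \<psi> x t) \<longrightarrow>
    (let b = \<alpha> N / (1 + \<alpha> N);
         Z = Zfield G \<Omega> k e0;
         chi = chi_star \<phi> G \<Omega> \<rho> (r_max U);
         ubar0 = (\<lambda>x. u0 x - \<Psi> x 0);
         M = M_star U T u;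
         E = E_star U T \<phi> \<Psi>
     in weighted_grad_integral U T b Z u
          \<le> ennreal (C * (chi\<^sup>2 * \<phi> * (L2_norm_on U ubar0)\<^sup>2
                + chi powr (2 * (4 + b)) * T * M\<^sup>2 * (M + 1)\<^sup>2
                + chi powr (2 * (2 + b)) * E)) \<and>
        power_grad_integral U T (2 - b) u
          \<le> ennreal (C * (chi\<^sup>2 * \<phi> * (L2_norm_on U ubar0)\<^sup>2
                + chi powr (2 * (4 + b)) * T * (M + 1)^4
                + chi powr (2 * (2 + b)) * E)) \<and>
        weighted_grad_integral U T b Z u
          \<le> ennreal (C * chi powr (2 * (4 + b)) * (M + 1)\<^sup>2 * N_zero U T \<phi> ubar0 u \<Psi>) \<and>
        weighted_grad_integral U T b Z u
          \<le> ennreal (C * chi powr (2 * (4 + b)) * (M + 1)^4 * N_star U T \<phi> ubar0 \<Psi>) \<and>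
        power_grad_integral U T (2 - b) u
          \<le> ennreal (C * chi powr (2 * (4 + b)) * (M + 1)^4 * N_star U T \<phi> ubar0 \<Psi>))"
proof -
  interpret forchheimer N a \<alpha> using assms(1-4) by unfold_locales
  obtain c1 where c1: "c1 > 0" and X_upper:
    "\<And>R k y. norm (X R k y) \<le> c1 * ((1 + norm y) powr - \<beta> * norm y)"
    using X_upper by blast
  obtain c2 where c2: "c2 > 0" and X_lower: "\<And>R k \<kappa> y. norm k = 1 \<Longrightarrow> 0 \<le> R \<Longrightarrow> R \<le> \<kappa> \<Longrightarrow> 1 \<le> \<kappa> \<Longrightarrow>
     c2 * ((1 + norm y) powr - \<beta> * (norm y)\<^sup>2) \<le> \<kappa>\<^sup>2 * (X R k y \<bullet> y)"
    using X_lower by blast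
  define V0 where "V0 = measure lborel U"
  \<comment> \<open>\<open>K0\<close> is the later \<open>C0\<close> written out. It involves only
    \<open>U\<close> and the growth constants \<open>c1\<close>, \<open>c2\<close>, so it can be
    fixed before the rotation, the force, the time and the solution are given.\<close>
  define K0 where "K0 = 2 / c2 * (1 / 2 + (c1\<^sup>2 / c2 + 1) * (1 + V0))"
  have V0: "V0 \<ge> 0" by (simp add: V0_def)
  have K0: "K0 > 0" unfolding K0_def using c1 c2 V0 by (intro mult_pos_pos add_pos_nonneg mult_nonneg_nonneg) auto
  note neg = C1_boundary_negligible_frontier[OF assms(5,8)]
  show ?thesis
  proof (intro exI[of _ "8 * K0 + 12 * V0"] conjI allI impI, goal_cases)
    case 1
    then show ?case using K0 V0 by simp
  next
    case (2 k \<phi> G \<Omega> \<rho> T e0 u u0 \<psi> \<Psi>)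
    define R where "R = Rconst \<phi> \<Omega> \<rho>"
    define r where "r = r_max U"
    define \<kappa> where "\<kappa> = chi_star \<phi> G \<Omega> \<rho> r"
    define Z where "Z = Zfield G \<Omega> k e0"
    define M where "M = M_star U T u"
    have r: "r > 0" unfolding r_def using assms by (intro r_max_pos)
    have R: "R \<ge> 0" using 2 by (simp add: R_def Rconst_def)
    note chi = chi_star_bounds[OF 2(2,4,5,6) r, folded \<kappa>_def R_def]
    obtain D H E where D: "continuous_on (closure U \<times> {0<..T}) (\<lambda>(x, t). D x t)"
      and H: "continuous_on (closure U \<times> {0<..T}) (\<lambda>(x, t). H x t)"
      and E: "continuous_on (closure U \<times> {0<..T}) (\<lambda>(x, t). E x t)"
      and DHE: "\<And>x t. x \<in> U \<Longrightarrow> t \<in> {0<..T} \<Longrightarrow> GDERIV (\<lambda>y. u y t) x :> D x t \<and>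
           ((\<lambda>y. D y t) has_derivative (\<lambda>h. H x t *v h)) (at x) \<and>
           (u x has_real_derivative E x t) (at t within {0..T})"
      using 2(10) unfolding C21_def by blast
    obtain D\<Psi> E\<Psi> where \<Psi>: "continuous_on (closure U \<times> {0..T}) (\<lambda>(x, t). \<Psi> x t)"
      and D\<Psi>: "continuous_on (closure U \<times> {0..T}) (\<lambda>(x, t). D\<Psi> x t)"
      and E\<Psi>: "continuous_on (closure U \<times> {0..T}) (\<lambda>(x, t). E\<Psi> x t)"
      and DE\<Psi>: "\<And>x t. x \<in> U \<Longrightarrow> t \<in> {0..T} \<Longrightarrow> GDERIV (\<lambda>y. \<Psi> y t) x :> D\<Psi> x t \<and>
           (\<Psi> x has_real_derivative E\<Psi> x t) (at t within {0..T})"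
      using 2(13) unfolding C1_cyl_def by blast
    note sol = 2(12)[unfolded solves_ibvp_def Xmap_eq, folded R_def Z_def]
    \<comment> \<open>The supremum \<open>M_star\<close> bounds \<open>u\<close> once the values are
      known to be bounded, which compactness of the closed cylinder provides.\<close>
    have u_le: "\<bar>u x t\<bar> \<le> M" if "x \<in> U" "t \<in> {0..T}" for x t
    proof -
      have "compact (closure U \<times> {0..T})" using assms(6) by (intro compact_Times) auto
      from compact_imp_bounded[OF compact_continuous_image[OF 2(11) this]]
      obtain B where B: "\<forall>z\<in>closure U \<times> {0..T}. \<bar>(\<lambda>(x, t). u x t) z\<bar> \<le> B"
        unfolding bounded_iff by auto
      have "bdd_above ((\<lambda>(x, t). \<bar>u x t\<bar>) ` (U \<times> {0..T}))"
        using B closure_subset by (intro bdd_aboveI2[of _ _ B]) fastforce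
      then show ?thesis
        unfolding M_def M_star_def using cSUP_upper[of "(x, t)" "U \<times> {0..T}" "\<lambda>(x, t). \<bar>u x t\<bar>"] that by simp
    qed
    obtain x0 where "x0 \<in> U" using assms(7) by blast
    then have M: "M \<ge> 0" using u_le[of x0 0] 2(7) by simp
    \<comment> \<open>At order 0 the iterated derivative is \<open>e0\<close> itself.\<close>
    have "e0 differentiable (at t)" for t
      using 2(8)[unfolded smooth_curve_def, rule_format, of 0 t] by simp
    then have e0: "continuous_on UNIV e0"
      by (simp add: continuous_at_imp_continuous_on differentiable_imp_continuous_within)
    \<comment> \<open>\<open>\<kappa>\<close> dominates the rotation constant, and its square the
      body force. The spatial derivative of the force is its linear centrifugal part, the same at
      all points and times.\<close>
    interpret flow U T \<phi> "a 0" c1 c2 \<beta> \<kappa> M "X R k" Z "\<lambda>x. \<Omega>\<^sup>2 *\<^sub>R cross3 k (cross3 k x)" u D H E \<Psi> D\<Psi> E\<Psi>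
    proof unfold_locales
      show "norm (X R k y) \<le> c1 * ((1 + norm y) powr - \<beta> * norm y)" for y by (rule X_upper)
      show "c2 * ((1 + norm y) powr - \<beta> * (norm y)\<^sup>2) \<le> \<kappa>\<^sup>2 * (X R k y \<bullet> y)" for y
        by (rule X_lower[OF 2(1) R chi(2,1)])
      show "continuous_on UNIV (\<lambda>(x, t). Z x t)" unfolding Z_def by (rule Zfield_continuous[OF e0])
      show "((\<lambda>x. Z x t) has_derivative (\<lambda>x. \<Omega>\<^sup>2 *\<^sub>R cross3 k (cross3 k x))) (at x)" for x t
        unfolding Z_def by (rule Zfield_has_derivative)
      show "norm (Z x t) \<le> \<kappa>\<^sup>2" if "x \<in> closure U" for x t
      proof -
        have "norm (Z x t) \<le> G + \<Omega>\<^sup>2 * norm x" unfolding Z_def using 2 by (intro norm_Zfield_le) auto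
        also have "\<dots> \<le> G + \<Omega>\<^sup>2 * r"
          unfolding r_def using r_max_ge[OF assms(6) that] by (intro add_left_mono mult_left_mono) auto
        finally show ?thesis using chi(3) by simp
      qed
      show "u x t = \<Psi> x t" if "x \<in> frontier U" "t \<in> {0<..T}" for x t
        using sol 2(14) that by auto
      show "\<phi> * E x t = divergence (\<lambda>y. X R k (D y t + (u y t)\<^sup>2 *\<^sub>R Z y t)) x" if x: "x \<in> U" and t: "t \<in> {0<..T}" for x t
      proof -
        have "time_deriv T u x t = E x t"
          using time_deriv_eq[of u x "E x t" t T] DHE[OF x t] t 2(7) by auto
        moreover have "divergence (\<lambda>y. X R k (flux_arg Z u y t)) x = divergence (\<lambda>y. X R k (D y t + (u y t)\<^sup>2 *\<^sub>R Z y t)) x"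
          by (rule divergence_cong_open[OF assms(5) x]) (simp add: flux_arg_def grad_eq[OF DHE[OF _ t, THEN conjunct1]])
        moreover have "\<phi> * time_deriv T u x t = divergence (\<lambda>y. X R k (flux_arg Z u y t)) x"
          using sol x t by blast
        ultimately show ?thesis by simp
      qed
    qed (rule assms(5,6) neg 2(2,3,7,11) c1 c2 \<beta> chi(1) M a0_pos X_continuous X_has_derivative D H E \<Psi> D\<Psi> E\<Psi> u_le
        DHE[THEN conjunct1] DHE[THEN conjunct2, THEN conjunct1] DHE[THEN conjunct2, THEN conjunct2]
        DE\<Psi>[THEN conjunct1] DE\<Psi>[THEN conjunct2]; assumption)+
    define a0 where "a0 = \<phi> * (L2_norm_on U (\<lambda>x. u0 x - \<Psi> x 0))\<^sup>2"
    define E0 where "E0 = E_star U T \<phi> \<Psi>"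
    have vol_eq: "vol = V0" by (simp add: V0_def vol_def)
    have a0: "\<phi> * W 0 = a0" unfolding a0_def using sol by (subst W_0_eq[of u0]) auto
    have E0: "E0 \<ge> 0" unfolding E0_def E_star_eq by (rule data_density_integral_nonneg)
    have C0_eq: "C0 = K0" by (simp add: K0_def C0_def c3_def vol_eq)
    have A_eq: "A = \<kappa>\<^sup>2 * a0 + \<kappa>^8 * (M\<^sup>2 * (M + 1)\<^sup>2) * T + \<kappa>^4 * E0"
      by (simp add: A_def a0 E0_def E_star_eq)
    have a0_nn: "a0 \<ge> 0" using 2 by (simp add: a0_def)
    note fin = final_bounds[OF chi(1) \<beta>(1) M less_imp_le[OF 2(7)] a0_nn E0 K0 V0]
    note w = weighted_grad_integral_le[unfolded vol_eq C0_eq A_eq]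
    note p = power_grad_integral_le[unfolded vol_eq C0_eq A_eq]
    note w1 = order_trans[OF w ennreal_leI[OF fin(1)]]
    note p1 = order_trans[OF p ennreal_leI[OF fin(2)]]
    note w2 = order_trans[OF w1 ennreal_leI[OF fin(3)]]
    \<comment> \<open>The weighted bound with \<open>N_star\<close> follows from the one with
      \<open>N_zero\<close>, because \<open>M^2 \<le> (M + 1)^2\<close> lets two powers of
      \<open>M + 1\<close> absorb the factor of \<open>T\<close>.\<close>
    note w3 = order_trans[OF w2 ennreal_leI[OF fin(5)]]
    note p2 = order_trans[OF p1 ennreal_leI[OF fin(4)]]
    show ?case
      unfolding Let_def N_zero_def N_star_def
      using w1 p1 w2 w3 p2
      by (simp only: \<beta>_def Z_def[symmetric] r_def[symmetric] \<kappa>_def[symmetric] M_def[symmetric]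
          E0_def[symmetric] a0_def mult.assoc[of "\<kappa>\<^sup>2" \<phi>])
  qed
qed

end
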